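(* Let $\nu\in(0,1)$ and $\alpha_1(\nu):=1-\nu$. Let $\{S(t):t\geq 0\}$ be a real-valued Lévy process such that $\log\mathbb{E}[e^{\theta S(1)}]$ is finite in a neighborhood of $\theta=0$; assume that $\{S(t):t\geq 0\}$ has bounded variation and is not a subordinator. Let $\{S_1(t):t\geq 0\}$ and $\{S_2(t):t\geq 0\}$ be two non-null independent subordinators such that $\{S(t):t\geq 0\}$ is distributed as $\{S_1(t)-S_2(t):t\geq 0\}$, and let $\kappa_{S_i}(\theta):=\log\mathbb{E}[e^{\theta S_i(1)}]$ and $m_i:=\kappa_{S_i}'(0)$ for $i=1,2$. Let $\{L_{\nu}^{(1)}(t):t\geq 0\}$ and $\{L_{\nu}^{(2)}(t):t\geq 0\}$ be two independent inverses of stable subordinators, both of index $\nu$, independent of $\{(S_1(t),S_2(t)):t\geq 0\}$. Then, for every family of positive numbers $\{a_t:t>0\}$ such that $a_t\to 0$ and $a_tt\to\infty$ as $t\to\infty$, the family of random variables $$\left\{(a_tt)^{\alpha_1(\nu)}\frac{S_1(L_\nu^{(1)}(t))-S_2(L_\nu^{(2)}(t))}{t}:t>0\right\}$$ satisfies the large deviation principle with speed $1/a_t$ and good rate function $J_{\mathrm{MD}}$ defined by $$J_{\mathrm{MD}}(x):=\begin{cases}\left(\nu^{\nu/(1-\nu)}-\nu^{1/(1-\nu)}\right)\left(\frac{x}{m_1}\right)^{1/(1-\nu)} & \text{if } x\geq 0,\\ \left(\nu^{\nu/(1-\nu)}-\nu^{1/(1-\nu)}\right)\left(-\frac{x}{m_2}\right)^{1/(1-\nu)}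 & \text{if } x<0.\end{cases}$$
   Context: A subordinator is a nondecreasing real-valued Lévy process; non-null means not identically zero. Under the stated assumptions on $S$ the functions $\kappa_{S_1},\kappa_{S_2}$ are finite in a neighborhood of the origin, and $m_1,m_2>0$. Inverse of a stable subordinator: for $\nu\in(0,1)$, $L_\nu(t)=\inf\{u\geq 0: H_\nu(u)>t\}$, where $\{H_\nu(u):u\ge 0\}$ is the stable subordinator with $\mathbb{E}[e^{-\xi H_\nu(u)}]=e^{-u\xi^\nu}$ for $\xi\geq 0$. Its moment generating function is $\mathbb{E}[e^{\theta L_\nu(t)}]=E_\nu(\theta t^\nu)$ for all $\theta\in\mathbb{R}$, where $E_\nu(x):=\sum_{k=0}^\infty\frac{x^k}{\Gamma(\nu k+1)}$ is the Mittag-Leffler function. Large deviation principle (LDP): a family of real random variables $\{Z(t):t>0\}$ satisfies the LDP with speed $v_t\to\infty$ and rate function $I:\mathbb{R}\to[0,\infty]$ (lower semicontinuous) if $\limsup_{t\to\infty}\frac{1}{v_t}\log P(Z(t)\in C)\leq-\inf_{x\in C}I(x)$ for all closed sets $C$ and $\liminf_{t\to\infty}\frac{1}{v_t}\log P(Z(t)\in O)\geq-\inf_{x\in O}I(x)$ for all open sets $O$. The rate function $I$ is good if all level sets $\{x\in\mathbb{R}:I(x)\leq b\}$, $b\geq 0$, are compact. *)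

theory Defs
  imports "HOL-Probability.Probability"
begin

text \<open>
  A real-valued stochastic process on a probability space \<open>M\<close> is a function
  \<open>X :: real \<Rightarrow> 'a \<Rightarrow> real\<close>; only its values at times \<open>t \<ge> 0\<close> are ever constrained.
\<close>

definition trajectory_space :: "(real \<Rightarrow> real) measure" where
  "trajectory_space = PiM {0..} (\<lambda>_. borel)"

definition trajectory :: "(real \<Rightarrow> 'a \<Rightarrow> real) \<Rightarrow> 'a \<Rightarrow> real \<Rightarrow> real" where
  "trajectory X \<omega> = (\<lambda>t\<in>{0..}. X t \<omega>)"

definition cadlag :: "(real \<Rightarrow> real) \<Rightarrow> bool" where
  "cadlag f \<longleftrightarrow> (\<forall>t\<ge>0. (f \<longlongrightarrow> f t) (at_right t)) \<and>
                (\<forall>t>0. \<exists>l. (f \<longlongrightarrow> l) (at_left t))"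

definition independent_increments :: "'a measure \<Rightarrow> (real \<Rightarrow> 'a \<Rightarrow> real) \<Rightarrow> bool" where
  "independent_increments M X \<longleftrightarrow>
    (\<forall>(n::nat) s. 0 \<le> s 0 \<and> (\<forall>i<n. s i < s (Suc i)) \<longrightarrow>
       prob_space.indep_vars M (\<lambda>_. borel) (\<lambda>i \<omega>. X (s (Suc i)) \<omega> - X (s i) \<omega>) {..<n})"

definition stationary_increments :: "'a measure \<Rightarrow> (real \<Rightarrow> 'a \<Rightarrow> real) \<Rightarrow> bool" where
  "stationary_increments M X \<longleftrightarrow>
    (\<forall>s\<ge>0. \<forall>t\<ge>0. distr M borel (\<lambda>\<omega>. X (s + t) \<omega> - X s \<omega>) = distr M borel (X t))"

text \<open>
  The path properties are only required almost surely. Stochastic continuity is implied by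
  right-continuity of the paths together with stationarity of the increments.
\<close>

definition levy_process :: "'a measure \<Rightarrow> (real \<Rightarrow> 'a \<Rightarrow> real) \<Rightarrow> bool" where
  "levy_process M X \<longleftrightarrow>
     prob_space M \<and>
     (\<forall>t\<ge>0. X t \<in> borel_measurable M) \<and>
     (AE \<omega> in M. X 0 \<omega> = 0) \<and>
     independent_increments M X \<and>
     stationary_increments M X \<and>
     (AE \<omega> in M. cadlag (\<lambda>t. X t \<omega>))"

definition subordinator :: "'a measure \<Rightarrow> (real \<Rightarrow> 'a \<Rightarrow> real) \<Rightarrow> bool" where
  "subordinator M X \<longleftrightarrow> levy_process M X \<and> (AE \<omega> in M. mono_on {0..} (\<lambda>t. X t \<omega>))"

definition non_null :: "'a measure \<Rightarrow> (real \<Rightarrow> 'a \<Rightarrow> real) \<Rightarrow> bool" where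
  "non_null M X \<longleftrightarrow> \<not> (AE \<omega> in M. \<forall>t\<ge>0. X t \<omega> = 0)"

definition finite_variation_on :: "real \<Rightarrow> (real \<Rightarrow> real) \<Rightarrow> bool" where
  "finite_variation_on T f \<longleftrightarrow>
    (\<exists>B. \<forall>(n::nat) s. 0 \<le> s 0 \<and> s n \<le> T \<and> (\<forall>i<n. s i \<le> s (Suc i)) \<longrightarrow>
       (\<Sum>i<n. \<bar>f (s (Suc i)) - f (s i)\<bar>) \<le> B)"

definition bounded_variation_process :: "'a measure \<Rightarrow> (real \<Rightarrow> 'a \<Rightarrow> real) \<Rightarrow> bool" where
  "bounded_variation_process M X \<longleftrightarrow>
     (AE \<omega> in M. \<forall>T\<ge>0. finite_variation_on T (\<lambda>t. X t \<omega>))"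

text \<open>
  \<open>kappa M X \<theta>\<close> is the logarithm of the moment generating function of \<open>X 1\<close>. Since the Bochner
  integral of a non-integrable function is \<open>0\<close>, its value is meaningful only where the exponential
  moment is finite, which is what \<open>kappa_finite_near_0\<close> expresses around the origin.
\<close>

definition kappa :: "'a measure \<Rightarrow> (real \<Rightarrow> 'a \<Rightarrow> real) \<Rightarrow> real \<Rightarrow> real" where
  "kappa M X \<theta> = ln (\<integral>\<omega>. exp (\<theta> * X 1 \<omega>) \<partial>M)"

definition kappa_finite_near_0 :: "'a measure \<Rightarrow> (real \<Rightarrow> 'a \<Rightarrow> real) \<Rightarrow> bool" where
  "kappa_finite_near_0 M X \<longleftrightarrow>
     (\<exists>\<delta>>0. \<forall>\<theta>. \<bar>\<theta>\<bar> < \<delta> \<longrightarrow> integrable M (\<lambda>\<omega>. exp (\<theta> * X 1 \<omega>)))"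

definition stable_subordinator :: "real \<Rightarrow> 'a measure \<Rightarrow> (real \<Rightarrow> 'a \<Rightarrow> real) \<Rightarrow> bool" where
  "stable_subordinator \<nu> M H \<longleftrightarrow>
     subordinator M H \<and>
     (\<forall>u\<ge>0. \<forall>\<xi>\<ge>0. (\<integral>\<omega>. exp (- \<xi> * H u \<omega>) \<partial>M) = exp (- u * \<xi> powr \<nu>))"

text \<open>
  The infimum is a real infimum: almost surely \<open>H\<close> is unbounded, so that the set is non-empty.
\<close>

definition inverse_stable_subordinator :: "real \<Rightarrow> 'a measure \<Rightarrow> (real \<Rightarrow> 'a \<Rightarrow> real) \<Rightarrow> bool" where
  "inverse_stable_subordinator \<nu> M L \<longleftrightarrow>
     (\<forall>t\<ge>0. L t \<in> borel_measurable M) \<and>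
     (\<exists>H. stable_subordinator \<nu> M H \<and>
          (AE \<omega> in M. \<forall>t\<ge>0. L t \<omega> = Inf {u. 0 \<le> u \<and> t < H u \<omega>}))"

definition log_prob :: "real \<Rightarrow> ereal" where
  "log_prob p = (if p = 0 then -\<infinity> else ereal (ln p))"

definition rate_function :: "(real \<Rightarrow> ereal) \<Rightarrow> bool" where
  "rate_function I \<longleftrightarrow> (\<forall>x. 0 \<le> I x) \<and> (\<forall>x. I x \<le> Liminf (at x) I)"

definition good_rate_function :: "(real \<Rightarrow> ereal) \<Rightarrow> bool" where
  "good_rate_function I \<longleftrightarrow>
     rate_function I \<and> (\<forall>b::real. 0 \<le> b \<longrightarrow> compact {x. I x \<le> ereal b})"

text \<open>
  Since cadlag paths are only required almost surely, a composition such as \<open>S (L t \<omega>) \<omega>\<close> need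
  not be \<open>M\<close>-measurable, but it is measurable with respect to \<open>completion M\<close>, on which the
  large deviation principle is then to be stated. The family is indexed by \<open>t > 0\<close>.
\<close>

definition satisfies_LDP ::
    "'a measure \<Rightarrow> (real \<Rightarrow> 'a \<Rightarrow> real) \<Rightarrow> (real \<Rightarrow> real) \<Rightarrow> (real \<Rightarrow> ereal) \<Rightarrow> bool" where
  "satisfies_LDP M Z v I \<longleftrightarrow>
     prob_space M \<and>
     (\<forall>t>0. Z t \<in> borel_measurable M) \<and>
     filterlim v at_top at_top \<and>
     rate_function I \<and>
     (\<forall>C. closed C \<longrightarrow>
        Limsup at_top (\<lambda>t. ereal (1 / v t) * log_prob (measure M {\<omega> \<in> space M. Z t \<omega> \<in> C}))
          \<le> - (INF x\<in>C. I x)) \<and>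
     (\<forall>G. open G \<longrightarrow>
        - (INF x\<in>G. I x)
          \<le> Liminf at_top (\<lambda>t. ereal (1 / v t) * log_prob (measure M {\<omega> \<in> space M. Z t \<omega> \<in> G})))"

definition alpha1 :: "real \<Rightarrow> real" where
  "alpha1 \<nu> = 1 - \<nu>"

definition J_MD :: "real \<Rightarrow> real \<Rightarrow> real \<Rightarrow> real \<Rightarrow> real" where
  "J_MD \<nu> m1 m2 x =
     (if 0 \<le> x
      then (\<nu> powr (\<nu> / (1 - \<nu>)) - \<nu> powr (1 / (1 - \<nu>))) * (x / m1) powr (1 / (1 - \<nu>))
      else (\<nu> powr (\<nu> / (1 - \<nu>)) - \<nu> powr (1 / (1 - \<nu>))) * (- x / m2) powr (1 / (1 - \<nu>)))"

end

theory Submission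
  imports Defs
begin

text \<open>
  The rate is that of the variable \<open>m1 * L1 t - m2 * L2 t\<close>: on the relevant scale the subordinators
  may be replaced by their means, and only the inverse stable time changes fluctuate. Put
  \<open>s t = (a t * t) powr \<nu> / a t\<close>. The normalisation is exactly division by \<open>s t\<close>, and
  \<open>s t\<close> exceeds the speed \<open>1 / a t\<close> by the factor \<open>(a t * t) powr \<nu>\<close>, which tends to infinity.
  A deviation of \<open>S1 u / u\<close> from its mean, for \<open>u\<close> of the order of \<open>s t\<close>, has probability
  at most \<open>exp (- k * u)\<close> and is therefore negligible at speed \<open>1 / a t\<close>.

  Because the paths of \<open>S1\<close> increase, the time change can be handled by set inclusions at fixed
  times. If \<open>S1 (L1 t) - S2 (L2 t)\<close> is at least \<open>x * s t\<close>, then for every \<open>u\<close> either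
  \<open>L1 t > u\<close> or \<open>S1 u\<close> is at least \<open>x * s t\<close>; with \<open>u\<close> slightly below \<open>x * s t / m1\<close> the
  second event is negligible. Conversely, if \<open>u\<close> is slightly above \<open>x * s t / m1\<close>, the events that
  \<open>L1 t > u\<close>, that \<open>S1 u\<close> is near its mean, and that \<open>L2 t\<close> and \<open>S2\<close> stay small on the scale
  \<open>s t\<close> together force the difference above \<open>x * s t\<close>; by independence their joint
  probability is, up to a constant, that of \<open>L1 t > u\<close> alone. This is
  \<open>time_changed_difference_right_tail\<close>; the left tail is the same statement with the two
  indices exchanged.

  What remains is the probability of \<open>L1 t > u\<close>, which by inversion is that of \<open>H u \<le> t\<close>.
  For \<open>u = z * s t\<close> the scaling of the stable subordinator makes the Laplace transform of \<open>H u / t\<close>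
  at \<open>l / a t\<close> equal to \<open>exp (- (z * l powr \<nu>) / a t)\<close>, as if \<open>H u / t\<close> were a mean of
  \<open>1 / a t\<close> independent copies of one variable. The exponential Markov inequality then gives the
  upper bound (\<open>stable_small_value_le\<close>) and an exponential change of measure the matching lower
  bound (\<open>stable_small_value_ge\<close>); the exponent is the minimum of \<open>l - z * l powr \<nu>\<close> over
  \<open>l\<close>, which is minus the rate at \<open>x = z * m1\<close>.

  Finally, the rate function vanishes only at the origin and is strictly monotone on each side of
  it, so the large deviation principle follows from the two tails
  (\<open>satisfies_LDP_of_tail_decay\<close>).
\<close>

section \<open>Large deviations from one-sided tails\<close>

lemma scaled_log_prob_le:
  assumes "0 < v" and "0 \<le> p" and "p \<le> exp (- (v * b))"
  shows "ereal (1 / v) * log_prob p \<le> ereal (- b)"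
proof (cases "p = 0")
  case True
  then show ?thesis using assms by (simp add: log_prob_def)
next
  case False
  then have "0 < p" using assms by simp
  then have "ln p \<le> - (v * b)"
    using assms(3) by (metis ln_exp ln_mono)
  then have "(1 / v) * ln p \<le> (1 / v) * (- (v * b))"
    using assms(1) by (intro mult_left_mono) auto
  then show ?thesis using assms(1) False by (simp add: log_prob_def)
qed

lemma scaled_log_prob_ge:
  assumes "0 < v" and "exp (- (v * b)) \<le> p"
  shows "ereal (- b) \<le> ereal (1 / v) * log_prob p"
proof -
  have p: "0 < p" using assms(2) exp_gt_zero less_le_trans by blast
  then have "- (v * b) \<le> ln p"
    using assms(2) by (metis exp_gt_zero ln_exp ln_mono)
  then have "(1 / v) * (- (v * b)) \<le> (1 / v) * ln p"
    using assms(1) by (intro mult_left_mono) auto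
  then show ?thesis using assms(1) p by (simp add: log_prob_def)
qed

text \<open>
  The closed half-line is the stronger choice in the upper estimate and the open one in the lower.
  Left tails are expressed by passing to \<open>- Z\<close> and \<open>\<lambda>x. J (- x)\<close>.
\<close>

definition right_tail_decay ::
    "'a measure \<Rightarrow> (real \<Rightarrow> 'a \<Rightarrow> real) \<Rightarrow> (real \<Rightarrow> real) \<Rightarrow> (real \<Rightarrow> real) \<Rightarrow> bool" where
  "right_tail_decay M Z v J \<longleftrightarrow>
     (\<forall>x>0. \<forall>\<epsilon>>0. \<forall>\<^sub>F t in at_top.
        measure M {\<omega> \<in> space M. x \<le> Z t \<omega>} \<le> exp (- (v t * (J x - \<epsilon>))) \<and>
        exp (- (v t * (J x + \<epsilon>))) \<le> measure M {\<omega> \<in> space M. x < Z t \<omega>})"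

lemma right_tail_decay_ge:
  assumes "right_tail_decay M Z v J" "0 < x" "0 < \<epsilon>"
  shows "\<forall>\<^sub>F t in at_top. measure M {\<omega> \<in> space M. x \<le> Z t \<omega>} \<le> exp (- (v t * (J x - \<epsilon>)))"
  using assms unfolding right_tail_decay_def by (auto simp: eventually_conj_iff)

lemma right_tail_decay_gt:
  assumes "right_tail_decay M Z v J" "0 < x" "0 < \<epsilon>"
  shows "\<forall>\<^sub>F t in at_top. exp (- (v t * (J x + \<epsilon>))) \<le> measure M {\<omega> \<in> space M. x < Z t \<omega>}"
  using assms unfolding right_tail_decay_def by (auto simp: eventually_conj_iff)

lemma right_tail_decay_cong:
  assumes "right_tail_decay M Z v J"
    and "\<And>t \<omega>. 0 < t \<Longrightarrow> Z' t \<omega> = Z t \<omega>" and "\<And>x. 0 < x \<Longrightarrow> J' x = J x"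
  shows "right_tail_decay M Z' v J'"
  unfolding right_tail_decay_def
proof (intro allI impI)
  fix x \<epsilon> :: real assume x: "0 < x" "0 < \<epsilon>"
  show "\<forall>\<^sub>F t in at_top.
      measure M {\<omega> \<in> space M. x \<le> Z' t \<omega>} \<le> exp (- (v t * (J' x - \<epsilon>))) \<and>
      exp (- (v t * (J' x + \<epsilon>))) \<le> measure M {\<omega> \<in> space M. x < Z' t \<omega>}"
    using right_tail_decay_ge[OF assms(1) x] right_tail_decay_gt[OF assms(1) x] eventually_gt_at_top[of 0]
    by eventually_elim (simp add: assms(2) assms(3)[OF x(1)])
qed

text \<open>
  Constant factors are invisible at the exponential scale: an arbitrarily small loss in the exponent
  pays for them.
\<close>

lemma two_exp_le_exp_eventually:
  assumes v: "filterlim v at_top F" and "b < (b' :: real)"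
  shows "\<forall>\<^sub>F t in F. 2 * exp (- (v t * b')) \<le> exp (- (v t * b))"
proof -
  have "\<forall>\<^sub>F t in F. ln 2 / (b' - b) \<le> v t"
    using v by (simp add: filterlim_at_top)
  then show ?thesis
  proof eventually_elim
    case (elim t)
    then have "ln 2 \<le> v t * (b' - b)"
      using assms(2) by (simp add: field_simps)
    then have "exp (ln 2 + - (v t * b')) \<le> exp (- (v t * b))"
      by (simp add: right_diff_distrib)
    then show ?case by (simp only: exp_add) simp
  qed
qed

text \<open>
  A neighbourhood of \<open>x\<close> contains the difference of the half-lines starting at \<open>x - \<delta>\<close> and \<open>x + \<delta>\<close>,
  and by strict monotonicity the second one is exponentially lighter than \<open>exp (- v * J x)\<close>.
\<close>

lemma (in prob_space) open_set_mass_ge: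
  assumes Z[measurable]: "\<And>t. 0 < t \<Longrightarrow> Z t \<in> borel_measurable M"
    and v: "filterlim v at_top at_top"
    and tail: "right_tail_decay M Z v J"
    and mono: "strict_mono_on {0..} J"
    and x: "0 < x" and G: "open G" "x \<in> G"
  shows "\<forall>\<^sub>F t in at_top. exp (- (v t * J x)) / 2 \<le> measure M {\<omega> \<in> space M. Z t \<omega> \<in> G}"
proof -
  obtain \<delta>0 where \<delta>0: "0 < \<delta>0" "ball x \<delta>0 \<subseteq> G"
    using G by (meson openE)
  define \<delta> where "\<delta> = min \<delta>0 x / 2"
  have \<delta>: "0 < \<delta>" "\<delta> < x" "\<delta> < \<delta>0" using \<delta>0 x by (auto simp: \<delta>_def)
  have lt: "J (x - \<delta>) < J x" "J x < J (x + \<delta>)"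
    using mono \<delta> by (auto simp: strict_mono_on_def)
  define \<eta> where "\<eta> = (J (x + \<delta>) - J x) / 2"
  have \<eta>: "0 < \<eta>" using lt by (simp add: \<eta>_def)
  have *: "J (x + \<delta>) - \<eta> = J x + \<eta>" by (simp add: \<eta>_def field_simps)
  have 1: "\<forall>\<^sub>F t in at_top. exp (- (v t * (J (x - \<delta>) + (J x - J (x - \<delta>)))))
      \<le> measure M {\<omega> \<in> space M. x - \<delta> < Z t \<omega>}"
    using lt \<delta> by (intro right_tail_decay_gt[OF tail]) auto
  have 2: "\<forall>\<^sub>F t in at_top. measure M {\<omega> \<in> space M. x + \<delta> \<le> Z t \<omega>}
      \<le> exp (- (v t * (J (x + \<delta>) - \<eta>)))"
    using \<delta> \<eta> by (intro right_tail_decay_ge[OF tail]) auto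
  have 3: "\<forall>\<^sub>F t in at_top. 2 * exp (- (v t * (J x + \<eta>))) \<le> exp (- (v t * J x))"
    using \<eta> by (intro two_exp_le_exp_eventually v) auto
  show ?thesis
    using 1 2 3 eventually_gt_at_top[of 0]
  proof eventually_elim
    case (elim t)
    note [measurable] = Z[OF elim(4)] borel_open[OF G(1)]
    have "measure M {\<omega> \<in> space M. x - \<delta> < Z t \<omega>}
        \<le> measure M ({\<omega> \<in> space M. Z t \<omega> \<in> G} \<union> {\<omega> \<in> space M. x + \<delta> \<le> Z t \<omega>})"
    proof (rule finite_measure_mono)
      show "{\<omega> \<in> space M. Z t \<omega> \<in> G} \<union> {\<omega> \<in> space M. x + \<delta> \<le> Z t \<omega>} \<in> sets M"
        by measurable
      show "{\<omega> \<in> space M. x - \<delta> < Z t \<omega>}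
          \<subseteq> {\<omega> \<in> space M. Z t \<omega> \<in> G} \<union> {\<omega> \<in> space M. x + \<delta> \<le> Z t \<omega>}"
        using \<delta>0(2) \<delta> by (force simp: subset_iff dist_real_def)
    qed
    also have "\<dots> \<le> measure M {\<omega> \<in> space M. Z t \<omega> \<in> G} + measure M {\<omega> \<in> space M. x + \<delta> \<le> Z t \<omega>}"
      by (intro measure_Un_le) measurable
    finally show ?case
      using elim(1-3) unfolding * by simp
  qed
qed

text \<open>
  A rate function on the line that decreases strictly to its only zero at the origin and then
  increases strictly is determined by tails: away from the origin a closed set lies in
  the union of two half-lines on which the rate is no smaller, and an open interval differs
  from a half-line by a half-line of exponentially smaller mass.
\<close>

lemma satisfies_LDP_of_tail_decay:
  assumes M: "prob_space M"
    and Z: "\<And>t. 0 < t \<Longrightarrow> Z t \<in> borel_measurable M"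
    and v: "filterlim v at_top at_top"
    and cont: "continuous_on UNIV J" and J0: "J 0 = 0"
    and mono: "strict_mono_on {0..} J" "strict_mono_on {0..} (\<lambda>x. J (- x))"
    and unb: "\<And>b. \<exists>x\<ge>0. b \<le> J x" "\<And>b. \<exists>x\<ge>0. b \<le> J (- x)"
    and right: "right_tail_decay M Z v J"
    and left: "right_tail_decay M (\<lambda>t \<omega>. - Z t \<omega>) v (\<lambda>x. J (- x))"
  shows "satisfies_LDP M Z v (\<lambda>x. ereal (J x)) \<and> good_rate_function (\<lambda>x. ereal (J x))"
proof -
  interpret prob_space M by (rule M)
  have pos: "0 < J x" if "x \<noteq> 0" for x
  proof (cases "0 < x")
    case True
    then show ?thesis using J0 mono(1)[THEN strict_mono_onD, of 0 x] by simp
  next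
    case False
    then show ?thesis using that J0 mono(2)[THEN strict_mono_onD, of 0 "- x"] by simp
  qed
  have vpos: "\<forall>\<^sub>F t in at_top. 0 < v t"
    using v unfolding filterlim_at_top_dense by blast
  have crossing: "\<exists>r>0. K r = b" if K: "\<exists>x\<ge>0. b \<le> K x" "continuous_on UNIV K" "K 0 = 0" "0 < b"
    for K :: "real \<Rightarrow> real" and b
  proof -
    obtain y where y: "0 \<le> y" "b \<le> K y" using K(1) by auto
    have "continuous_on {0..y} K" using K(2) continuous_on_subset by blast
    then obtain r where r: "0 \<le> r" "K r = b" using y K(3,4) IVT'[of K 0 b y] by auto
    then have "r \<noteq> 0" using K(3,4) by auto
    then show ?thesis using r by (intro exI[of _ r]) auto
  qed
  have contm: "continuous_on UNIV (\<lambda>x. J (- x))"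
    by (intro continuous_on_compose2[OF cont] continuous_intros) auto

  have rate: "rate_function (\<lambda>x. ereal (J x))"
    unfolding rate_function_def
  proof (intro conjI allI)
    fix x
    show "0 \<le> ereal (J x)" using pos[of x] J0 by (cases "x = 0") (auto simp: less_imp_le)
    have "(J \<longlongrightarrow> J x) (at x)"
      using cont by (simp add: continuous_on_eq_continuous_at isCont_def)
    then have "((\<lambda>y. ereal (J y)) \<longlongrightarrow> ereal (J x)) (at x)" by simp
    then show "ereal (J x) \<le> Liminf (at x) (\<lambda>x. ereal (J x))"
      using lim_imp_Liminf[of "at x" "\<lambda>y. ereal (J y)" "ereal (J x)"] by simp
  qed
  have compact: "compact {x. J x \<le> b}" for b
  proof -
    obtain y where y: "0 \<le> y" "b + 1 \<le> J y" using unb by blast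
    obtain z where z: "0 \<le> z" "b + 1 \<le> J (- z)" using unb by blast
    have "{x. J x \<le> b} \<subseteq> {- z..y}"
    proof
      fix x assume "x \<in> {x. J x \<le> b}"
      then show "x \<in> {- z..y}"
        using y z mono(1)[THEN strict_mono_onD, of y x] mono(2)[THEN strict_mono_onD, of z "- x"]
        by (cases "x < - z"; cases "y < x") auto
    qed
    then have "bounded {x. J x \<le> b}" using bounded_subset bounded_closed_interval by blast
    moreover have "closed {x. J x \<le> b}"
      using cont by (intro closed_Collect_le) auto
    ultimately show ?thesis by (simp add: compact_eq_bounded_closed)
  qed

  have upper: "Limsup at_top (\<lambda>t. ereal (1 / v t) *
      log_prob (measure M {\<omega> \<in> space M. Z t \<omega> \<in> C})) \<le> - (INF x\<in>C. ereal (J x))"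
    if C: "closed C" for C
  proof -
    let ?P = "\<lambda>t. measure M {\<omega> \<in> space M. Z t \<omega> \<in> C}"
    let ?L = "Limsup at_top (\<lambda>t. ereal (1 / v t) * log_prob (?P t))"
    have *: "?L \<le> ereal (- b)" if b: "ereal b < (INF x\<in>C. ereal (J x))" for b
    proof (rule Limsup_bounded)
      have "\<forall>\<^sub>F t in at_top. ?P t \<le> exp (- (v t * b))"
      proof (cases "b < 0")
        case True
        show ?thesis using vpos
        proof eventually_elim
          case (elim t)
          then have "1 \<le> exp (- (v t * b))" using True by (simp add: mult_pos_neg less_imp_le)
          then show ?case using prob_le_1 order_trans by blast
        qed
      next
        case False
        obtain b' where b': "b < b'" "ereal b' < (INF x\<in>C. ereal (J x))"
          using ereal_dense2[OF b] by auto
        have Cb: "b' < J x" if "x \<in> C" for x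
          using b'(2) that by (meson INF_lower less_le_trans less_ereal.simps(1))
        obtain r where r: "0 < r" "J r = b'"
          using crossing[of b' J] unb cont J0 False b' by force
        obtain q where q: "0 < q" "J (- q) = b'"
          using crossing[of b' "\<lambda>x. J (- x)"] unb contm J0 False b' by force
        have sub: "r \<le> x \<or> q \<le> - x" if "x \<in> C" for x
          using Cb[OF that] r q mono(1)[THEN strict_mono_onD, of x r]
            mono(2)[THEN strict_mono_onD, of "- x" q]
          by (cases "r \<le> x"; cases "q \<le> - x"; cases "0 \<le> x") auto
        \<comment> \<open>half of the gap absorbs the error in the tails, the other half the factor 2 from the union\<close>
        define \<epsilon> where "\<epsilon> = (b' - b) / 2"
        have \<epsilon>: "0 < \<epsilon>" "b < b' - \<epsilon>" using b' by (auto simp: \<epsilon>_def field_simps)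
        show ?thesis
          using right_tail_decay_ge[OF right r(1) \<epsilon>(1)] right_tail_decay_ge[OF left q(1) \<epsilon>(1)]
            two_exp_le_exp_eventually[OF v \<epsilon>(2)] eventually_gt_at_top[of 0]
        proof eventually_elim
          case (elim t)
          note [measurable] = Z[OF elim(4)] borel_closed[OF C]
          have "?P t \<le> measure M ({\<omega> \<in> space M. r \<le> Z t \<omega>} \<union> {\<omega> \<in> space M. q \<le> - Z t \<omega>})"
            using sub by (intro finite_measure_mono) auto
          also have "\<dots> \<le> measure M {\<omega> \<in> space M. r \<le> Z t \<omega>} + measure M {\<omega> \<in> space M. q \<le> - Z t \<omega>}"
            by (intro measure_Un_le) measurable
          finally show ?case using elim(1-3) r q by simp
        qed
      qed
      then show "\<forall>\<^sub>F t in at_top. ereal (1 / v t) * log_prob (?P t) \<le> ereal (- b)"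
        using vpos by eventually_elim (auto intro!: scaled_log_prob_le)
    qed
    have "(INF x\<in>C. ereal (J x)) \<le> - ?L"
    proof (rule dense_le)
      fix y assume y: "y < (INF x\<in>C. ereal (J x))"
      show "y \<le> - ?L"
      proof (cases y)
        case (real b)
        then have "?L \<le> - ereal b" using *[of b] y by simp
        then have "- (- ereal b) \<le> - ?L" by (simp only: ereal_minus_le_minus)
        then show ?thesis using real by simp
      qed (use y in auto)
    qed
    then have "- (- ?L) \<le> - (INF x\<in>C. ereal (J x))" by (simp only: ereal_minus_le_minus)
    then show ?thesis by simp
  qed

  have lower: "- (INF x\<in>G. ereal (J x)) \<le> Liminf at_top (\<lambda>t. ereal (1 / v t) *
      log_prob (measure M {\<omega> \<in> space M. Z t \<omega> \<in> G}))"
    if G: "open G" for G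
  proof -
    let ?P = "\<lambda>t. measure M {\<omega> \<in> space M. Z t \<omega> \<in> G}"
    let ?L = "Liminf at_top (\<lambda>t. ereal (1 / v t) * log_prob (?P t))"
    have mass: "\<forall>\<^sub>F t in at_top. exp (- (v t * J x)) / 2 \<le> ?P t" if x: "x \<in> G" for x
    proof -
      consider "0 < x" | "x < 0" | "x = 0" by linarith
      then show ?thesis
      proof cases
        case 1
        then show ?thesis
          using Z v right mono(1) G x by (intro open_set_mass_ge) auto
      next
        case 2
        have "open (uminus -` G)"
          by (rule open_vimage[OF G]) (intro continuous_intros)
        then have "\<forall>\<^sub>F t in at_top. exp (- (v t * J (- (- x)))) / 2
            \<le> measure M {\<omega> \<in> space M. - Z t \<omega> \<in> uminus -` G}"
          using Z v left mono(2) 2 x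
          by (intro open_set_mass_ge[where J = "\<lambda>x. J (- x)"]) auto
        then show ?thesis by simp
      next
        case 3
        obtain \<delta> where \<delta>: "0 < \<delta>" "ball 0 \<delta> \<subseteq> G"
          using G x 3 by (meson openE)
        have small: "\<forall>\<^sub>F t in at_top. exp (- (v t * (b - b / 2))) \<le> 1 / 4" if "0 < b" for b :: real
        proof -
          have "\<forall>\<^sub>F t in at_top. ln 4 / (b / 2) \<le> v t" using v by (simp add: filterlim_at_top)
          then show ?thesis
          proof eventually_elim
            case (elim t)
            then have "- (v t * (b - b / 2)) \<le> - ln 4" using that by (simp add: field_simps)
            then have "exp (- (v t * (b - b / 2))) \<le> exp (- ln 4)" by simp
            then show ?case by (simp add: exp_minus)
          qed
        qed
        have p: "0 < J \<delta>" "0 < J (- \<delta>)" using pos \<delta> by auto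
        show ?thesis
          using right_tail_decay_ge[OF right \<delta>(1) half_gt_zero[OF p(1)]]
            right_tail_decay_ge[OF left \<delta>(1) half_gt_zero[OF p(2)]]
            small[OF p(1)] small[OF p(2)] eventually_gt_at_top[of 0]
        proof eventually_elim
          case (elim t)
          note [measurable] = Z[OF elim(5)] borel_open[OF G]
          have "1 = measure M (space M)" by (simp add: prob_space)
          also have "\<dots> \<le> measure M ({\<omega> \<in> space M. Z t \<omega> \<in> G} \<union>
              ({\<omega> \<in> space M. \<delta> \<le> Z t \<omega>} \<union> {\<omega> \<in> space M. \<delta> \<le> - Z t \<omega>}))"
          proof (rule finite_measure_mono)
            show "{\<omega> \<in> space M. Z t \<omega> \<in> G} \<union>
              ({\<omega> \<in> space M. \<delta> \<le> Z t \<omega>} \<union> {\<omega> \<in> space M. \<delta> \<le> - Z t \<omega>}) \<in> sets M"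
              by measurable
            show "space M \<subseteq> {\<omega> \<in> space M. Z t \<omega> \<in> G} \<union>
              ({\<omega> \<in> space M. \<delta> \<le> Z t \<omega>} \<union> {\<omega> \<in> space M. \<delta> \<le> - Z t \<omega>})"
              using \<delta>(2) by (force simp: subset_iff dist_real_def)
          qed
          also have "\<dots> \<le> ?P t + measure M ({\<omega> \<in> space M. \<delta> \<le> Z t \<omega>} \<union> {\<omega> \<in> space M. \<delta> \<le> - Z t \<omega>})"
            by (intro measure_Un_le) measurable
          also have "measure M ({\<omega> \<in> space M. \<delta> \<le> Z t \<omega>} \<union> {\<omega> \<in> space M. \<delta> \<le> - Z t \<omega>})
              \<le> measure M {\<omega> \<in> space M. \<delta> \<le> Z t \<omega>} + measure M {\<omega> \<in> space M. \<delta> \<le> - Z t \<omega>}"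
            by (intro measure_Un_le) measurable
          finally have "1 \<le> ?P t + (1 / 4 + 1 / 4)" using elim(1-4) by linarith
          then show ?case using 3 J0 by simp
        qed
      qed
    qed
    have *: "ereal (- J x - \<epsilon>) \<le> ?L" if x: "x \<in> G" and \<epsilon>: "0 < \<epsilon>" for x \<epsilon>
    proof -
      have "\<forall>\<^sub>F t in at_top. 2 * exp (- (v t * (J x + \<epsilon>))) \<le> exp (- (v t * J x))"
        using \<epsilon> by (intro two_exp_le_exp_eventually v) auto
      then have "\<forall>\<^sub>F t in at_top. ereal (- (J x + \<epsilon>)) \<le> ereal (1 / v t) * log_prob (?P t)"
        using vpos mass[OF x] by eventually_elim (rule scaled_log_prob_ge, auto)
      moreover have "- (J x + \<epsilon>) = - J x - \<epsilon>" by simp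
      ultimately show ?thesis by (intro Liminf_bounded) (simp only:)
    qed
    have "- ?L \<le> ereal (J x)" if x: "x \<in> G" for x
    proof (rule ereal_le_epsilon2)
      fix \<epsilon> :: real assume "0 < \<epsilon>"
      then have "ereal (- J x - \<epsilon>) \<le> ?L" using * x by blast
      then have "- ?L \<le> - ereal (- J x - \<epsilon>)" by (simp only: ereal_minus_le_minus)
      then show "- ?L \<le> ereal (J x) + ereal \<epsilon>" by (simp add: add.commute)
    qed
    then have "- ?L \<le> (INF x\<in>G. ereal (J x))" by (intro INF_greatest)
    then show ?thesis by (simp add: ereal_uminus_le_reorder)
  qed
  show ?thesis
    unfolding satisfies_LDP_def good_rate_function_def
    using M Z v rate upper lower compact by auto
qed

section \<open>Small values under a stable Laplace transform\<close>

text \<open>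
  This is minus the minimum over \<open>l > 0\<close> of \<open>l - z * l powr \<nu>\<close>, attained at
  \<open>l = (\<nu> * z) powr (1 / (1 - \<nu>))\<close>.
\<close>

definition stable_rate :: "real \<Rightarrow> real \<Rightarrow> real" where
  "stable_rate \<nu> z = (\<nu> powr (\<nu> / (1 - \<nu>)) - \<nu> powr (1 / (1 - \<nu>))) * z powr (1 / (1 - \<nu>))"

lemma stable_rate_factor_pos:
  fixes \<nu> :: real
  assumes "0 < \<nu>" "\<nu> < 1"
  shows "0 < \<nu> powr (\<nu> / (1 - \<nu>)) - \<nu> powr (1 / (1 - \<nu>))"
proof -
  have "\<nu> / (1 - \<nu>) < 1 / (1 - \<nu>)" using assms by (intro divide_strict_right_mono) auto
  then have "\<nu> powr (1 / (1 - \<nu>)) < \<nu> powr (\<nu> / (1 - \<nu>))"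
    using assms by (intro powr_less_mono') auto
  then show ?thesis by simp
qed

lemma legendre_at_critical_point:
  assumes "0 < \<nu>" "\<nu> < 1" "0 < z"
  shows "(\<nu> * z) powr (1 / (1 - \<nu>)) - z * ((\<nu> * z) powr (1 / (1 - \<nu>))) powr \<nu> = - stable_rate \<nu> z"
proof -
  have "1 / (1 - \<nu>) = 1 + \<nu> / (1 - \<nu>)" using assms by (simp add: field_simps)
  then have "z powr (1 / (1 - \<nu>)) = z * z powr (\<nu> / (1 - \<nu>))"
    using assms by (simp only: powr_add) simp
  moreover have "((\<nu> * z) powr (1 / (1 - \<nu>))) powr \<nu> = (\<nu> * z) powr (\<nu> / (1 - \<nu>))"
    by (simp add: powr_powr)
  ultimately show ?thesis
    using assms by (simp only: stable_rate_def powr_mult) (simp add: algebra_simps)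
qed

context prob_space
begin

text \<open>
  The integral of a non-integrable function is \<open>0\<close>, which is not in the range of the exponential.
\<close>

lemma integrable_of_integral_exp:
  fixes f :: "'a \<Rightarrow> real"
  assumes "expectation f = exp r"
  shows "integrable M f"
  using assms not_integrable_integral_eq[of M f] by fastforce

lemma stable_small_value_le:
  assumes "0 < \<nu>" "\<nu> < 1" "0 < z" "0 < s"
    and X[measurable]: "X \<in> borel_measurable M"
    and LT: "\<And>l. 0 \<le> l \<Longrightarrow> expectation (\<lambda>\<omega>. exp (- (s * l * X \<omega>))) = exp (- (s * (z * l powr \<nu>)))"
  shows "prob {\<omega> \<in> space M. X \<omega> \<le> 1} \<le> exp (- (s * stable_rate \<nu> z))"
proof -
  define l where "l = (\<nu> * z) powr (1 / (1 - \<nu>))"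
  have l: "0 < l" using assms by (simp add: l_def)
  have "prob {\<omega> \<in> space M. X \<omega> \<le> 1} \<le> prob {\<omega> \<in> space M. exp (- (s * l * X \<omega>)) \<ge> exp (- (s * l))}"
    using l assms(4) by (intro finite_measure_mono) (auto simp: mult_le_cancel_left)
  also have "\<dots> \<le> expectation (\<lambda>\<omega>. exp (- (s * l * X \<omega>))) / exp (- (s * l))"
    using l integrable_of_integral_exp[OF LT[of l]]
    by (intro integral_Markov_inequality_measure[where A = "space M"]) auto
  also have "\<dots> = exp (s * (l - z * l powr \<nu>))"
    using l by (simp add: LT exp_diff[symmetric] right_diff_distrib)
  also have "l - z * l powr \<nu> = - stable_rate \<nu> z"
    unfolding l_def by (rule legendre_at_critical_point[OF assms(1-3)])
  finally show ?thesis by simp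
qed

text \<open>
  Change of measure without constructing the tilted measure, whose density is proportional to
  \<open>exp (- s * l * X)\<close>. Raising or lowering the tilt \<open>l\<close> shows that the parts of \<open>E exp (- s * l * X)\<close>
  carried by \<open>X > 1\<close> and by \<open>X < y\<close> are each at most a quarter of the whole. Half of
  it therefore comes from \<open>y \<le> X \<le> 1\<close>, where the integrand is at most \<open>exp (- s * l * y)\<close>.
\<close>

lemma exponential_tilting_lower_bound:
  assumes X[measurable]: "X \<in> borel_measurable M" and s: "0 < s"
    and LT: "\<And>l. 0 \<le> l \<Longrightarrow> expectation (\<lambda>\<omega>. exp (- (s * l * X \<omega>))) = exp (- (s * K l))"
    and l: "0 \<le> l" "0 \<le> \<mu>" "\<mu> \<le> l" "0 \<le> \<rho>"
    and up: "K l + \<eta> \<le> K (l - \<mu>) + \<mu>"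
    and low: "K l + \<eta> \<le> K (l + \<rho>) - \<rho> * y"
    and sbig: "ln 4 \<le> s * \<eta>"
  shows "exp (s * (l * y - K l)) / 2 \<le> prob {\<omega> \<in> space M. X \<omega> \<le> 1}"
proof -
  let ?A = "{\<omega> \<in> space M. y \<le> X \<omega> \<and> X \<omega> \<le> 1}"
  let ?E = "\<lambda>l \<omega>. exp (- (s * l * X \<omega>))"
  have [simp, intro]: "integrable M (?E l)" if "0 \<le> l" for l
    using integrable_of_integral_exp[OF LT[OF that]] .
  have point: "?E l \<omega> \<le> indicator ?A \<omega> * exp (- (s * l * y))
      + (?E (l - \<mu>) \<omega> * exp (- (s * \<mu>)) + ?E (l + \<rho>) \<omega> * exp (s * \<rho> * y))"
    if "\<omega> \<in> space M" for \<omega>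
  proof -
    consider "y \<le> X \<omega> \<and> X \<omega> \<le> 1" | "1 < X \<omega>" | "X \<omega> < y" by linarith
    then show ?thesis
    proof cases
      case 1
      then have "?E l \<omega> \<le> exp (- (s * l * y))" using s l by (simp add: mult_left_mono)
      then show ?thesis using 1 that by (simp add: add_increasing2)
    next
      case 2
      then have "s * \<mu> * 1 \<le> s * \<mu> * X \<omega>" using s l by (intro mult_left_mono) auto
      then have "?E l \<omega> \<le> ?E (l - \<mu>) \<omega> * exp (- (s * \<mu>))"
        by (simp add: exp_add[symmetric] algebra_simps)
      moreover have "0 \<le> indicator ?A \<omega> * exp (- (s * l * y))" "0 \<le> ?E (l + \<rho>) \<omega> * exp (s * \<rho> * y)"
        by simp_all
      ultimately show ?thesis by linarith
    next
      case 3
      then have "s * \<rho> * X \<omega> \<le> s * \<rho> * y" using s l by (intro mult_left_mono) auto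
      then have "?E l \<omega> \<le> ?E (l + \<rho>) \<omega> * exp (s * \<rho> * y)"
        by (simp add: exp_add[symmetric] algebra_simps)
      moreover have "0 \<le> indicator ?A \<omega> * exp (- (s * l * y))" "0 \<le> ?E (l - \<mu>) \<omega> * exp (- (s * \<mu>))"
        by simp_all
      ultimately show ?thesis by linarith
    qed
  qed
  have [measurable]: "?A \<in> sets M" by measurable
  have iA: "integrable M (\<lambda>\<omega>. indicator ?A \<omega> * exp (- (s * l * y)))"
    by (intro integrable_mult_left integrable_real_indicator) (auto simp: emeasure_eq_measure)
  have "exp (- (s * K l)) = expectation (?E l)"
    using LT l by simp
  also have "\<dots> \<le> expectation (\<lambda>\<omega>. indicator ?A \<omega> * exp (- (s * l * y))
      + (?E (l - \<mu>) \<omega> * exp (- (s * \<mu>)) + ?E (l + \<rho>) \<omega> * exp (s * \<rho> * y)))"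
    using l iA point by (intro integral_mono) auto
  also have "\<dots> = prob ?A * exp (- (s * l * y))
      + (exp (- (s * K (l - \<mu>))) * exp (- (s * \<mu>)) + exp (- (s * K (l + \<rho>))) * exp (s * \<rho> * y))"
    using l iA by (simp add: LT)
  also have "exp (- (s * K (l - \<mu>))) * exp (- (s * \<mu>)) = exp (- (s * (K (l - \<mu>) + \<mu>)))"
    by (simp add: exp_add[symmetric] algebra_simps)
  also have "\<dots> \<le> exp (- (s * (K l + \<eta>)))"
    using up s by simp
  also have "exp (- (s * K (l + \<rho>))) * exp (s * \<rho> * y) = exp (- (s * (K (l + \<rho>) - \<rho> * y)))"
    by (simp add: exp_add[symmetric] algebra_simps)
  also have "\<dots> \<le> exp (- (s * (K l + \<eta>)))"
    using low s by simp
  finally have 1: "exp (- (s * K l)) \<le> prob ?A * exp (- (s * l * y)) + 2 * exp (- (s * (K l + \<eta>)))"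
    by simp
  have "exp (- (s * (K l + \<eta>))) = exp (- (s * K l)) * exp (- (s * \<eta>))"
    by (simp add: exp_add[symmetric] algebra_simps)
  also have "exp (- (s * \<eta>)) \<le> exp (- ln 4)" using sbig by simp
  also have "exp (- ln (4 :: real)) = 1 / 4" by (simp add: exp_minus)
  finally have "exp (- (s * K l)) / 2 \<le> prob ?A * exp (- (s * l * y))"
    using 1 by simp
  then have "exp (- (s * K l)) / 2 * exp (s * l * y) \<le> prob ?A * exp (- (s * l * y)) * exp (s * l * y)"
    by (intro mult_right_mono) auto
  moreover have "exp (s * (l * y - K l)) = exp (- (s * K l)) * exp (s * l * y)"
    by (simp add: exp_add[symmetric] algebra_simps)
  ultimately have "exp (s * (l * y - K l)) / 2 \<le> prob ?A"
    by (simp add: mult.assoc exp_add[symmetric])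
  also have "\<dots> \<le> prob {\<omega> \<in> space M. X \<omega> \<le> 1}"
    by (intro finite_measure_mono) auto
  finally show ?thesis .
qed

end

text \<open>
  The derivative of \<open>K\<close> at \<open>l\<close> is the mean of \<open>X\<close> under the tilted measure. The tilt \<open>l\<close> is chosen
  such that it equals \<open>1 - \<delta>\<close>, the midpoint of \<open>[1 - 2 * \<delta>, 1]\<close>. The two inequalities then
  hold strictly to first order in the perturbations \<open>\<mu>\<close> and \<open>\<rho>\<close>, with slope \<open>\<delta>\<close> in both cases, and the exponent
  converges to the optimal one as \<open>\<delta>\<close> tends to \<open>0\<close>.
\<close>

lemma exists_tilting_parameters:
  assumes \<nu>: "0 < \<nu>" "\<nu> < 1" and z: "0 < z" and \<epsilon>: "0 < \<epsilon>"
  defines "K \<equiv> \<lambda>l. z * l powr \<nu>"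
  obtains l \<mu> \<rho> y \<eta> :: real
  where "0 < l" "0 < \<mu>" "\<mu> \<le> l" "0 < \<rho>" "0 < \<eta>"
    and "K l + \<eta> \<le> K (l - \<mu>) + \<mu>" "K l + \<eta> \<le> K (l + \<rho>) - \<rho> * y"
    and "- (stable_rate \<nu> z + \<epsilon>) \<le> l * y - K l"
proof -
  define p where "p = 1 / (1 - \<nu>)"
  define f where "f \<delta> = (\<nu> * z / (1 - \<delta>)) powr p * (1 - 2 * \<delta>) - K ((\<nu> * z / (1 - \<delta>)) powr p)" for \<delta>
  have "(f \<longlongrightarrow> (\<nu> * z / (1 - 0)) powr p * (1 - 2 * 0) - K ((\<nu> * z / (1 - 0)) powr p)) (at_right 0)"
    unfolding f_def K_def using \<nu> z by (intro tendsto_intros) auto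
  then have "(f \<longlongrightarrow> - stable_rate \<nu> z) (at_right 0)"
    using legendre_at_critical_point[OF \<nu> z] by (simp add: K_def p_def)
  then have "\<forall>\<^sub>F \<delta> in at_right 0. - stable_rate \<nu> z - \<epsilon> < f \<delta>"
    using \<epsilon> by (intro order_tendstoD(1)) auto
  moreover have "\<forall>\<^sub>F \<delta> in at_right 0. \<delta> < (1 :: real)" "\<forall>\<^sub>F \<delta> in at_right 0. 0 < (\<delta> :: real)"
    by (auto intro: eventually_at_right_less simp: eventually_at_right[of 0 1] intro!: exI[of _ 1])
  ultimately have "\<forall>\<^sub>F \<delta> in at_right 0. - stable_rate \<nu> z - \<epsilon> < f \<delta> \<and> \<delta> < 1 \<and> 0 < \<delta>"
    by (simp add: eventually_conj_iff)
  then obtain \<delta> where \<delta>: "- stable_rate \<nu> z - \<epsilon> < f \<delta>" "\<delta> < 1" "0 < \<delta>"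
    using eventually_happens'[OF trivial_limit_at_right_real] by blast
  define l where "l = (\<nu> * z / (1 - \<delta>)) powr p"
  have l: "0 < l" using \<nu> z \<delta> by (simp add: l_def)
  have "p * (\<nu> - 1) = - 1" using \<nu> by (simp add: p_def field_simps)
  then have "l powr (\<nu> - 1) = (\<nu> * z / (1 - \<delta>)) powr (- 1)"
    by (simp add: l_def powr_powr)
  then have crit: "z * (\<nu> * l powr (\<nu> - 1)) = 1 - \<delta>"
    using \<nu> z \<delta> by (simp add: powr_minus field_simps)
  have dK: "(K has_real_derivative 1 - \<delta>) (at l)"
    unfolding K_def crit[symmetric] using l
    by (auto intro!: derivative_eq_intros)
  have "((\<lambda>\<mu>. K (l - \<mu>) + \<mu> - K l) has_real_derivative (1 - \<delta>) * (- 1) + 1 - 0) (at 0)"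
    using dK by (intro derivative_intros DERIV_chain2[where f = K]) (auto intro!: derivative_eq_intros)
  from DERIV_pos_inc_right[OF this] \<delta> obtain d1 where d1: "0 < d1"
    "\<And>h. 0 < h \<Longrightarrow> h < d1 \<Longrightarrow> 0 < K (l - h) + h - K l"
    by auto
  have "((\<lambda>\<mu>. K (l + \<mu>) - \<mu> * (1 - 2 * \<delta>) - K l) has_real_derivative (1 - \<delta>) * 1 - (1 - 2 * \<delta>) - 0) (at 0)"
    using dK by (intro derivative_intros DERIV_chain2[where f = K]) (auto intro!: derivative_eq_intros)
  from DERIV_pos_inc_right[OF this] \<delta> obtain d2 where d2: "0 < d2"
    "\<And>h. 0 < h \<Longrightarrow> h < d2 \<Longrightarrow> 0 < K (l + h) - h * (1 - 2 * \<delta>) - K l"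
    by auto
  define \<mu> where "\<mu> = min (d1 / 2) l"
  define \<rho> where "\<rho> = d2 / 2"
  have pos: "0 < \<mu>" "\<mu> \<le> l" "0 < \<rho>" using l d1 d2 by (auto simp: \<mu>_def \<rho>_def)
  have "0 < K (l - \<mu>) + \<mu> - K l" "0 < K (l + \<rho>) - \<rho> * (1 - 2 * \<delta>) - K l"
    using d1(1) d2(1) l by (auto intro!: d1(2) d2(2) simp: \<mu>_def \<rho>_def
        simp del: less_diff_eq diff_gt_0_iff_gt times_divide_eq_left)
  then show thesis
    using that[of l \<mu> \<rho> "min (K (l - \<mu>) + \<mu> - K l) (K (l + \<rho>) - \<rho> * (1 - 2 * \<delta>) - K l)"
      "1 - 2 * \<delta>"] l pos \<delta>(1)
    by (auto simp: f_def l_def[symmetric])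
qed

text \<open>
  The threshold \<open>s0\<close> depends on \<open>\<nu>\<close>, \<open>z\<close> and \<open>\<epsilon>\<close> only and not on \<open>X\<close>, as the bound is to be applied to
  a different variable for each \<open>s\<close>.
\<close>

lemma (in prob_space) stable_small_value_ge:
  assumes \<nu>: "0 < \<nu>" "\<nu> < 1" and z: "0 < z" and \<epsilon>: "0 < \<epsilon>"
  shows "\<exists>s0. \<forall>s\<ge>s0. \<forall>X \<in> borel_measurable M.
    (\<forall>l\<ge>0. expectation (\<lambda>\<omega>. exp (- (s * l * X \<omega>))) = exp (- (s * (z * l powr \<nu>)))) \<longrightarrow>
    exp (- (s * (stable_rate \<nu> z + \<epsilon>))) \<le> prob {\<omega> \<in> space M. X \<omega> \<le> 1}"
proof -
  have "0 < \<epsilon> / 2" using \<epsilon> by simp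
  from exists_tilting_parameters[OF \<nu> z this]
  obtain l \<mu> \<rho> y \<eta> where par: "0 < l" "0 < \<mu>" "\<mu> \<le> l" "0 < \<rho>" "0 < \<eta>"
    "z * l powr \<nu> + \<eta> \<le> z * (l - \<mu>) powr \<nu> + \<mu>"
    "z * l powr \<nu> + \<eta> \<le> z * (l + \<rho>) powr \<nu> - \<rho> * y"
    "- (stable_rate \<nu> z + \<epsilon> / 2) \<le> l * y - z * l powr \<nu>"
    by metis
  show ?thesis
  proof (intro exI[of _ "max 1 (max (ln 4 / \<eta>) (ln 2 / (\<epsilon> / 2)))"] allI ballI impI)
    fix s X
    assume s: "max 1 (max (ln 4 / \<eta>) (ln 2 / (\<epsilon> / 2))) \<le> s"
      and X: "X \<in> borel_measurable M"
      and LT: "\<forall>l\<ge>0. expectation (\<lambda>\<omega>. exp (- (s * l * X \<omega>))) = exp (- (s * (z * l powr \<nu>)))"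
    have s': "0 < s" "ln 4 \<le> s * \<eta>" "ln 2 \<le> s * (\<epsilon> / 2)"
      using s par \<epsilon> by (auto simp: field_simps)
    have "- (s * (stable_rate \<nu> z + \<epsilon>)) + ln 2 \<le> - (s * (stable_rate \<nu> z + \<epsilon> / 2))"
      using s'(3) by (simp add: distrib_left)
    also have "\<dots> \<le> s * (l * y - z * l powr \<nu>)"
      using mult_left_mono[OF par(8), of s] s'(1) by (simp only: mult_minus_right)
    finally have "exp (- (s * (stable_rate \<nu> z + \<epsilon>)) + ln 2) \<le> exp (s * (l * y - z * l powr \<nu>))"
      by simp
    then have "exp (- (s * (stable_rate \<nu> z + \<epsilon>))) \<le> exp (s * (l * y - z * l powr \<nu>)) / 2"
      by (simp only: exp_add) simp
    also have "\<dots> \<le> prob {\<omega> \<in> space M. X \<omega> \<le> 1}"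
      using X s' par LT by (intro exponential_tilting_lower_bound[where K = "\<lambda>l. z * l powr \<nu>" and \<eta> = \<eta> and \<mu> = \<mu> and \<rho> = \<rho>]) auto
    finally show "exp (- (s * (stable_rate \<nu> z + \<epsilon>))) \<le> prob {\<omega> \<in> space M. X \<omega> \<le> 1}" .
  qed
qed

section \<open>Tails of the inverse stable subordinator\<close>

lemma subordinatorD:
  assumes "subordinator M X"
  shows "prob_space M" "\<And>t. 0 \<le> t \<Longrightarrow> X t \<in> borel_measurable M" "AE \<omega> in M. X 0 \<omega> = 0"
    "AE \<omega> in M. mono_on {0..} (\<lambda>t. X t \<omega>)" "AE \<omega> in M. cadlag (\<lambda>t. X t \<omega>)"
    "independent_increments M X" "stationary_increments M X" "levy_process M X"
  using assms by (auto simp: subordinator_def levy_process_def)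

lemma subordinator_nonneg:
  assumes "subordinator M X"
  shows "AE \<omega> in M. \<forall>t\<ge>0. 0 \<le> X t \<omega>"
  using subordinatorD(3,4)[OF assms]
proof eventually_elim
  case (elim \<omega>)
  then show ?case using mono_onD[OF elim(2), of 0] by auto
qed

text \<open>
  The Laplace transform at \<open>1\<close> bounds the probability of \<open>H n \<le> t\<close> by \<open>exp (t - n)\<close>.
\<close>

lemma stable_subordinator_unbounded:
  assumes H: "stable_subordinator \<nu> M H"
  shows "AE \<omega> in M. \<exists>u\<ge>0. t < H u \<omega>"
proof -
  have sub: "subordinator M H"
    and LT: "\<And>u \<xi>. 0 \<le> u \<Longrightarrow> 0 \<le> \<xi> \<Longrightarrow> (\<integral>\<omega>. exp (- \<xi> * H u \<omega>) \<partial>M) = exp (- u * \<xi> powr \<nu>)"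
    using H by (auto simp: stable_subordinator_def)
  interpret prob_space M by (rule subordinatorD(1)[OF sub])
  have [measurable]: "H u \<in> borel_measurable M" if "0 \<le> u" for u
    using subordinatorD(2)[OF sub that] .
  have [measurable]: "H (real n) \<in> borel_measurable M" for n by simp
  let ?B = "{\<omega> \<in> space M. \<forall>n::nat. H (real n) \<omega> \<le> t}"
  have le: "prob ?B \<le> exp t * exp (- real n)" for n
  proof -
    have E: "expectation (\<lambda>\<omega>. exp (- H (real n) \<omega>)) = exp (- real n)"
      using LT[of "real n" 1] by simp
    have "prob ?B \<le> prob {\<omega> \<in> space M. exp (- H (real n) \<omega>) \<ge> exp (- t)}"
      by (intro finite_measure_mono) auto
    also have "\<dots> \<le> exp (- real n) / exp (- t)"
      unfolding E[symmetric] using integrable_of_integral_exp[OF E]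
      by (intro integral_Markov_inequality_measure[where A = "space M"]) auto
    finally show ?thesis by (simp add: exp_minus field_simps)
  qed
  have "(\<lambda>n. exp t * exp (- real n)) \<longlonglongrightarrow> exp t * 0"
    by (intro tendsto_intros filterlim_compose[OF exp_at_bot]
        filterlim_compose[OF filterlim_uminus_at_bot_at_top filterlim_real_sequentially])
  then have "prob ?B \<le> exp t * 0"
    by (rule LIMSEQ_le_const) (use le in blast)
  then have "prob ?B = 0" using measure_nonneg[of M ?B] by linarith
  then have "AE \<omega> in M. \<not> (\<forall>n::nat. H (real n) \<omega> \<le> t)"
    by (subst (asm) prob_Collect_eq_0) auto
  then show ?thesis
    by eventually_elim (metis not_le of_nat_0_le_iff)
qed

text \<open>
  First passage inverts the path: since \<open>H\<close> is nondecreasing, \<open>L t\<close> separates the times \<open>u\<close> with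
  \<open>H u \<le> t\<close> from those with \<open>H u > t\<close>. At \<open>u = L t\<close> itself \<open>H\<close> may already have
  jumped over the level \<open>t\<close>, hence one strict and one weak inequality.
\<close>

lemma inverse_stable_subordinator_duality:
  assumes L: "inverse_stable_subordinator \<nu> M L"
  shows "\<exists>H. stable_subordinator \<nu> M H \<and> (\<forall>t\<ge>0. AE \<omega> in M. 0 \<le> L t \<omega> \<and>
      (\<forall>u\<ge>0. (u < L t \<omega> \<longrightarrow> H u \<omega> \<le> t) \<and> (H u \<omega> \<le> t \<longrightarrow> u \<le> L t \<omega>)))"
proof -
  obtain H where H: "stable_subordinator \<nu> M H"
    and Inf: "AE \<omega> in M. \<forall>t\<ge>0. L t \<omega> = Inf {u. 0 \<le> u \<and> t < H u \<omega>}"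
    using L unfolding inverse_stable_subordinator_def by blast
  have mono: "AE \<omega> in M. mono_on {0..} (\<lambda>u. H u \<omega>)"
    using H by (auto simp: stable_subordinator_def subordinatorD)
  have "AE \<omega> in M. 0 \<le> L t \<omega> \<and>
      (\<forall>u\<ge>0. (u < L t \<omega> \<longrightarrow> H u \<omega> \<le> t) \<and> (H u \<omega> \<le> t \<longrightarrow> u \<le> L t \<omega>))" if t: "0 \<le> t" for t
    using Inf mono stable_subordinator_unbounded[OF H, of t]
  proof eventually_elim
    case (elim \<omega>)
    let ?U = "{u. 0 \<le> u \<and> t < H u \<omega>}"
    have L: "L t \<omega> = Inf ?U" using elim(1) t by blast
    have ne: "?U \<noteq> {}" using elim(3) by auto
    have bdd: "bdd_below ?U" by (rule bdd_belowI[of _ 0]) auto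
    have "H u \<omega> \<le> t" if "0 \<le> u" "u < L t \<omega>" for u
      using that cInf_lower[OF _ bdd, of u] unfolding L by fastforce
    moreover have "u \<le> L t \<omega>" if "0 \<le> u" "H u \<omega> \<le> t" for u
      unfolding L
    proof (rule cInf_greatest[OF ne])
      fix w assume "w \<in> ?U"
      then show "u \<le> w"
        using that mono_onD[OF elim(2), of w u] by (cases "u \<le> w") auto
    qed
    moreover have "0 \<le> L t \<omega>" unfolding L by (rule cInf_greatest[OF ne]) auto
    ultimately show ?case by blast
  qed
  then show ?thesis using H by blast
qed

text \<open>
  The time \<open>z * (b * t) powr \<nu> / b\<close> is the one for which the level \<open>t\<close> drops out, so that
  \<open>H u / t\<close> has the Laplace transform required by the small value estimates with \<open>s = 1 / b\<close>.
\<close>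

lemma stable_subordinator_scaling:
  assumes "stable_subordinator \<nu> M H" "0 < t" "0 < b" "0 \<le> z" "0 \<le> l"
  shows "(\<integral>\<omega>. exp (- (1 / b * l * (H (z * ((b * t) powr \<nu> / b)) \<omega> / t))) \<partial>M)
    = exp (- (1 / b * (z * l powr \<nu>)))"
proof -
  have "(\<integral>\<omega>. exp (- \<xi> * H u \<omega>) \<partial>M) = exp (- u * \<xi> powr \<nu>)" if "0 \<le> u" "0 \<le> \<xi>" for u \<xi>
    using assms(1) that by (simp add: stable_subordinator_def)
  from this[of "z * ((b * t) powr \<nu> / b)" "l / (b * t)"]
  have "(\<integral>\<omega>. exp (- (l / (b * t)) * H (z * ((b * t) powr \<nu> / b)) \<omega>) \<partial>M)
      = exp (- (z * ((b * t) powr \<nu> / b)) * (l / (b * t)) powr \<nu>)"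
    using assms by simp
  then show ?thesis
    using assms by (simp add: powr_divide field_simps)
qed

lemma inverse_stable_upper_tail_le:
  assumes \<nu>: "0 < \<nu>" "\<nu> < 1" and L: "inverse_stable_subordinator \<nu> M L"
    and pos: "0 < z" "0 < t" "0 < b"
  shows "measure M {\<omega> \<in> space M. z * ((b * t) powr \<nu> / b) < L t \<omega>}
    \<le> exp (- (1 / b * stable_rate \<nu> z))"
proof -
  obtain H where H: "stable_subordinator \<nu> M H"
    and dual: "\<And>t. 0 \<le> t \<Longrightarrow> AE \<omega> in M. 0 \<le> L t \<omega> \<and>
      (\<forall>u\<ge>0. (u < L t \<omega> \<longrightarrow> H u \<omega> \<le> t) \<and> (H u \<omega> \<le> t \<longrightarrow> u \<le> L t \<omega>))"
    using inverse_stable_subordinator_duality[OF L] by blast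
  have sub: "subordinator M H" using H by (simp add: stable_subordinator_def)
  interpret prob_space M by (rule subordinatorD(1)[OF sub])
  define u where "u = z * ((b * t) powr \<nu> / b)"
  have u: "0 \<le> u" using pos by (simp add: u_def)
  have [measurable]: "H u \<in> borel_measurable M" using subordinatorD(2)[OF sub u] .
  have "prob {\<omega> \<in> space M. u < L t \<omega>} \<le> prob {\<omega> \<in> space M. H u \<omega> / t \<le> 1}"
  proof (rule finite_measure_mono_AE)
    show "AE \<omega> in M. \<omega> \<in> {\<omega> \<in> space M. u < L t \<omega>} \<longrightarrow> \<omega> \<in> {\<omega> \<in> space M. H u \<omega> / t \<le> 1}"
      using dual[OF less_imp_le[OF pos(2)]]
    proof eventually_elim
      case (elim \<omega>)
      then have "u < L t \<omega> \<longrightarrow> H u \<omega> \<le> t" using u by blast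
      then show ?case using pos by simp
    qed
  qed measurable
  also have "\<dots> \<le> exp (- (1 / b * stable_rate \<nu> z))"
  proof (rule stable_small_value_le[OF \<nu> pos(1)])
    show "0 < 1 / b" using pos by simp
    show "expectation (\<lambda>\<omega>. exp (- (1 / b * l * (H u \<omega> / t)))) = exp (- (1 / b * (z * l powr \<nu>)))"
      if "0 \<le> l" for l
      using stable_subordinator_scaling[OF H pos(2,3) less_imp_le[OF pos(1)] that, folded u_def] .
  qed measurable
  finally show ?thesis by (simp add: u_def)
qed

lemma continuous_stable_rate:
  assumes "\<nu> < 1" "0 < z"
  shows "isCont (stable_rate \<nu>) z"
  unfolding stable_rate_def using assms by (intro continuous_intros) auto

text \<open>
  The small value estimate is applied at some \<open>w\<close> slightly larger than \<open>z\<close>: from \<open>H u \<le> t\<close> one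
  only obtains \<open>u \<le> L t\<close>, and the strict inequality is gained from \<open>z < w\<close>.
\<close>

lemma inverse_stable_upper_tail_ge:
  assumes \<nu>: "0 < \<nu>" "\<nu> < 1" and L: "inverse_stable_subordinator \<nu> M L"
    and z: "0 < z" and \<epsilon>: "0 < \<epsilon>"
  shows "\<exists>s0. \<forall>b t. 0 < t \<longrightarrow> 0 < b \<longrightarrow> s0 \<le> 1 / b \<longrightarrow>
    exp (- (1 / b * (stable_rate \<nu> z + \<epsilon>)))
      \<le> measure M {\<omega> \<in> space M. z * ((b * t) powr \<nu> / b) < L t \<omega>}"
proof -
  obtain H where H: "stable_subordinator \<nu> M H"
    and dual: "\<And>t. 0 \<le> t \<Longrightarrow> AE \<omega> in M. 0 \<le> L t \<omega> \<and>
      (\<forall>u\<ge>0. (u < L t \<omega> \<longrightarrow> H u \<omega> \<le> t) \<and> (H u \<omega> \<le> t \<longrightarrow> u \<le> L t \<omega>))"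
    using inverse_stable_subordinator_duality[OF L] by blast
  have sub: "subordinator M H" using H by (simp add: stable_subordinator_def)
  interpret prob_space M by (rule subordinatorD(1)[OF sub])
  have "(stable_rate \<nu> \<longlongrightarrow> stable_rate \<nu> z) (at_right z)"
    using continuous_stable_rate[OF \<nu>(2) z]
    by (simp add: isCont_def filterlim_at_split)
  then have "\<forall>\<^sub>F w in at_right z. stable_rate \<nu> w < stable_rate \<nu> z + \<epsilon> / 2"
    using \<epsilon> by (intro order_tendstoD(2)) auto
  moreover have "\<forall>\<^sub>F w in at_right z. z < w" by (rule eventually_at_right_less)
  ultimately have "\<forall>\<^sub>F w in at_right z. stable_rate \<nu> w < stable_rate \<nu> z + \<epsilon> / 2 \<and> z < w"
    by (rule eventually_conj)
  then obtain w where w: "stable_rate \<nu> w < stable_rate \<nu> z + \<epsilon> / 2" "z < w"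
    using eventually_happens'[OF trivial_limit_at_right_real] by blast
  have w0: "0 < w" "0 < \<epsilon> / 2" using w z \<epsilon> by auto
  obtain s0 where s0: "\<forall>s\<ge>s0. \<forall>X \<in> borel_measurable M.
    (\<forall>l\<ge>0. expectation (\<lambda>\<omega>. exp (- (s * l * X \<omega>))) = exp (- (s * (w * l powr \<nu>)))) \<longrightarrow>
    exp (- (s * (stable_rate \<nu> w + \<epsilon> / 2))) \<le> prob {\<omega> \<in> space M. X \<omega> \<le> 1}"
    using stable_small_value_ge[OF \<nu> w0] by blast
  show ?thesis
  proof (intro exI[of _ s0] allI impI)
    fix b t :: real assume bt: "0 < t" "0 < b" "s0 \<le> 1 / b"
    define u where "u = w * ((b * t) powr \<nu> / b)"
    have "0 < (b * t) powr \<nu> / b" using bt by simp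
    from mult_strict_right_mono[OF w(2) this]
    have u: "0 \<le> u" "z * ((b * t) powr \<nu> / b) < u"
      unfolding u_def using w0 bt by simp_all
    have [measurable]: "H u \<in> borel_measurable M" using subordinatorD(2)[OF sub u(1)] .
    have [measurable]: "L t \<in> borel_measurable M"
      using L bt by (simp add: inverse_stable_subordinator_def)
    have "exp (- (1 / b * (stable_rate \<nu> z + \<epsilon>))) \<le> exp (- (1 / b * (stable_rate \<nu> w + \<epsilon> / 2)))"
      using w bt by (simp add: divide_right_mono)
    also have "\<dots> \<le> prob {\<omega> \<in> space M. H u \<omega> / t \<le> 1}"
    proof (rule s0[rule_format, OF bt(3)])
      show "expectation (\<lambda>\<omega>. exp (- (1 / b * l * (H u \<omega> / t)))) = exp (- (1 / b * (w * l powr \<nu>)))"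
        if "0 \<le> l" for l
        using stable_subordinator_scaling[OF H bt(1,2) less_imp_le[OF w0(1)] that, folded u_def] .
    qed measurable
    also have "\<dots> \<le> prob {\<omega> \<in> space M. z * ((b * t) powr \<nu> / b) < L t \<omega>}"
    proof (rule finite_measure_mono_AE)
      show "AE \<omega> in M. \<omega> \<in> {\<omega> \<in> space M. H u \<omega> / t \<le> 1}
          \<longrightarrow> \<omega> \<in> {\<omega> \<in> space M. z * ((b * t) powr \<nu> / b) < L t \<omega>}"
        using dual[OF less_imp_le[OF bt(1)]]
      proof eventually_elim
        case (elim \<omega>)
        then have "H u \<omega> \<le> t \<longrightarrow> u \<le> L t \<omega>" using u by blast
        then show ?case using bt u by auto
      qed
    qed measurable
    finally show "exp (- (1 / b * (stable_rate \<nu> z + \<epsilon>)))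
      \<le> measure M {\<omega> \<in> space M. z * ((b * t) powr \<nu> / b) < L t \<omega>}" .
  qed
qed

section \<open>Moment generating functions of subordinators\<close>

text \<open>
  \<open>X n\<close> is a sum of \<open>n\<close> independent increments with the law of \<open>X 1\<close>.
\<close>

lemma integer_time_mgf:
  assumes X: "levy_process M X" and int: "integrable M (\<lambda>\<omega>. exp (\<theta> * X 1 \<omega>))"
  shows "integrable M (\<lambda>\<omega>. exp (\<theta> * X (real n) \<omega>))"
    and "(\<integral>\<omega>. exp (\<theta> * X (real n) \<omega>) \<partial>M) = (\<integral>\<omega>. exp (\<theta> * X 1 \<omega>) \<partial>M) ^ n"
proof -
  interpret prob_space M using X by (simp add: levy_process_def)
  have meas[measurable]: "X t \<in> borel_measurable M" if "0 \<le> t" for t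
    using X that by (simp add: levy_process_def)
  have [measurable]: "X (real i) \<in> borel_measurable M" "X 1 \<in> borel_measurable M" for i by simp_all
  define D where "D i \<omega> = X (real (Suc i)) \<omega> - X (real i) \<omega>" for i \<omega>
  have D[measurable]: "D i \<in> borel_measurable M" for i unfolding D_def by measurable
  have "indep_vars (\<lambda>_. borel) D {..<n}"
    using X unfolding levy_process_def independent_increments_def D_def
    by (elim conjE allE[where x = n] allE[where x = real]) auto
  then have indep: "indep_vars (\<lambda>_. borel) (\<lambda>i \<omega>. exp (\<theta> * D i \<omega>)) {..<n}"
    by (rule indep_vars_compose2) measurable
  have dist: "distr M borel (D i) = distr M borel (X 1)" for i
  proof -
    have "distr M borel (\<lambda>\<omega>. X (real i + 1) \<omega> - X (real i) \<omega>) = distr M borel (X 1)"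
      using X unfolding levy_process_def stationary_increments_def by auto
    then show ?thesis by (simp add: D_def[abs_def] add.commute)
  qed
  have "integrable (distr M borel (D i)) (\<lambda>x. exp (\<theta> * x))" for i
    unfolding dist by (subst integrable_distr_eq) (auto intro: int)
  then have Dint: "integrable M (\<lambda>\<omega>. exp (\<theta> * D i \<omega>))" for i
    by (subst (asm) integrable_distr_eq) auto
  have "(\<integral>x. exp (\<theta> * x) \<partial>distr M borel (D i)) = (\<integral>\<omega>. exp (\<theta> * X 1 \<omega>) \<partial>M)" for i
    unfolding dist by (subst integral_distr) auto
  then have DE: "(\<integral>\<omega>. exp (\<theta> * D i \<omega>) \<partial>M) = (\<integral>\<omega>. exp (\<theta> * X 1 \<omega>) \<partial>M)" for i
    by (subst (asm) integral_distr) auto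
  have ae: "AE \<omega> in M. exp (\<theta> * X (real n) \<omega>) = (\<Prod>i<n. exp (\<theta> * D i \<omega>))"
  proof -
    have "AE \<omega> in M. X 0 \<omega> = 0" using X by (simp add: levy_process_def)
    then show ?thesis
    proof eventually_elim
      case (elim \<omega>)
      have "(\<Sum>i<n. D i \<omega>) = X (real n) \<omega> - X (real 0) \<omega>"
        unfolding D_def by (rule sum_lessThan_telescope)
      then show ?case
        using elim by (simp add: exp_sum[symmetric] sum_distrib_left[symmetric])
    qed
  qed
  show "integrable M (\<lambda>\<omega>. exp (\<theta> * X (real n) \<omega>))"
    by (subst integrable_cong_AE[OF _ _ ae])
      (auto intro!: indep_vars_integrable indep Dint)
  show "(\<integral>\<omega>. exp (\<theta> * X (real n) \<omega>) \<partial>M) = (\<integral>\<omega>. exp (\<theta> * X 1 \<omega>) \<partial>M) ^ n"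
    by (subst integral_cong_AE[OF _ _ ae])
      (auto simp: indep_vars_lebesgue_integral[OF finite_lessThan indep Dint] DE)
qed

text \<open>
  Taylor's formula, with one half of the available exponential moment spent on the remainder and
  the other half on the factor \<open>x\<^sup>2\<close>.
\<close>

lemma exp_diff_quadratic_bound:
  fixes x \<theta> \<delta> :: real
  assumes "0 \<le> x" "0 < \<delta>" "\<bar>\<theta>\<bar> \<le> \<delta> / 2"
  shows "\<bar>exp (\<theta> * x) - 1 - \<theta> * x\<bar> \<le> \<theta>\<^sup>2 * (4 / \<delta>\<^sup>2) * exp (\<delta> * x)"
proof -
  obtain s where s: "\<bar>s\<bar> \<le> \<bar>\<theta> * x\<bar>"
    "exp (\<theta> * x) = (\<Sum>m<2. (\<theta> * x) ^ m / fact m) + exp s / fact 2 * (\<theta> * x) ^ 2"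
    using Maclaurin_exp_le by blast
  have "exp (\<theta> * x) - 1 - \<theta> * x = exp s / 2 * (\<theta> * x)\<^sup>2"
    using s(2) by (simp add: numeral_2_eq_2)
  then have "\<bar>exp (\<theta> * x) - 1 - \<theta> * x\<bar> = exp s / 2 * (\<theta> * x)\<^sup>2"
    by (simp only:) (rule abs_of_nonneg, simp)
  then have eq: "\<bar>exp (\<theta> * x) - 1 - \<theta> * x\<bar> = \<theta>\<^sup>2 * (exp s * (x\<^sup>2 / 2))"
    by (simp only: power_mult_distrib) simp
  have "\<bar>\<theta> * x\<bar> \<le> \<delta> / 2 * x"
    unfolding abs_mult using assms mult_right_mono[OF assms(3,1)] by simp
  then have "exp s \<le> exp (\<delta> / 2 * x)" using s(1) by simp
  moreover have "x\<^sup>2 / 2 \<le> 4 / \<delta>\<^sup>2 * exp (\<delta> / 2 * x)"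
  proof -
    have "0 \<le> \<delta> / 2 * x" using assms by simp
    with exp_lower_Taylor_quadratic[OF this]
    have "(\<delta> / 2 * x)\<^sup>2 / 2 \<le> exp (\<delta> / 2 * x)" by linarith
    then have "4 / \<delta>\<^sup>2 * ((\<delta> / 2 * x)\<^sup>2 / 2) \<le> 4 / \<delta>\<^sup>2 * exp (\<delta> / 2 * x)"
      by (intro mult_left_mono) auto
    then show ?thesis using assms by (simp add: power2_eq_square)
  qed
  ultimately have "exp s * (x\<^sup>2 / 2) \<le> exp (\<delta> / 2 * x) * (4 / \<delta>\<^sup>2 * exp (\<delta> / 2 * x))"
    by (intro mult_mono) auto
  also have "\<dots> = 4 / \<delta>\<^sup>2 * exp (\<delta> * x)"
    by (simp add: exp_add[symmetric])
  finally show ?thesis unfolding eq mult.assoc by (rule mult_left_mono) simp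
qed

lemma (in prob_space) mgf_has_derivative_at_0:
  assumes X[measurable]: "X \<in> borel_measurable M" and nonneg: "AE \<omega> in M. 0 \<le> X \<omega>"
    and \<delta>: "0 < \<delta>" and int: "integrable M (\<lambda>\<omega>. exp (\<delta> * X \<omega>))"
  shows "integrable M X"
    and "((\<lambda>\<theta>. expectation (\<lambda>\<omega>. exp (\<theta> * X \<omega>))) has_real_derivative expectation X) (at 0)"
proof -
  show intX: "integrable M X"
  proof (rule Bochner_Integration.integrable_bound)
    show "integrable M (\<lambda>\<omega>. exp (\<delta> * X \<omega>) / \<delta>)" using int by simp
    show "AE \<omega> in M. norm (X \<omega>) \<le> norm (exp (\<delta> * X \<omega>) / \<delta>)"
      using nonneg
    proof eventually_elim
      case (elim \<omega>)
      have "\<delta> * X \<omega> \<le> exp (\<delta> * X \<omega>)" using exp_ge_add_one_self[of "\<delta> * X \<omega>"] by linarith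
      then show ?case using elim \<delta> by (simp add: field_simps)
    qed
  qed simp
  define \<phi> where "\<phi> \<theta> = expectation (\<lambda>\<omega>. exp (\<theta> * X \<omega>))" for \<theta>
  define C where "C = 4 / \<delta>\<^sup>2 * expectation (\<lambda>\<omega>. exp (\<delta> * X \<omega>))"
  have \<phi>0: "\<phi> 0 = 1" by (simp add: \<phi>_def prob_space)
  have quad: "\<bar>\<phi> \<theta> - 1 - \<theta> * expectation X\<bar> \<le> \<theta>\<^sup>2 * C" if \<theta>: "\<bar>\<theta>\<bar> \<le> \<delta> / 2" for \<theta>
  proof -
    have i1: "integrable M (\<lambda>\<omega>. exp (\<theta> * X \<omega>))"
    proof (rule Bochner_Integration.integrable_bound[OF int])
      show "AE \<omega> in M. norm (exp (\<theta> * X \<omega>)) \<le> norm (exp (\<delta> * X \<omega>))"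
        using nonneg by eventually_elim (use \<theta> \<delta> in \<open>auto intro!: mult_right_mono\<close>)
    qed simp
    have "\<phi> \<theta> - 1 - \<theta> * expectation X = expectation (\<lambda>\<omega>. exp (\<theta> * X \<omega>) - 1 - \<theta> * X \<omega>)"
      using i1 intX by (simp add: \<phi>_def prob_space)
    also have "\<bar>\<dots>\<bar> \<le> expectation (\<lambda>\<omega>. \<bar>exp (\<theta> * X \<omega>) - 1 - \<theta> * X \<omega>\<bar>)"
      by (rule integral_abs_bound)
    also have "\<dots> \<le> expectation (\<lambda>\<omega>. \<theta>\<^sup>2 * (4 / \<delta>\<^sup>2) * exp (\<delta> * X \<omega>))"
    proof (rule integral_mono_AE)
      show "AE \<omega> in M. \<bar>exp (\<theta> * X \<omega>) - 1 - \<theta> * X \<omega>\<bar> \<le> \<theta>\<^sup>2 * (4 / \<delta>\<^sup>2) * exp (\<delta> * X \<omega>)"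
        using nonneg by eventually_elim (rule exp_diff_quadratic_bound[OF _ \<delta> \<theta>])
    qed (use i1 intX int in auto)
    finally show ?thesis by (simp add: C_def)
  qed
  have "((\<lambda>h. (\<phi> (0 + h) - \<phi> 0) / h - expectation X) \<longlongrightarrow> 0) (at 0)"
  proof (rule Lim_null_comparison)
    show "((\<lambda>h. C * \<bar>h\<bar>) \<longlongrightarrow> 0) (at 0)"
      by (auto intro!: tendsto_eq_intros)
    have "\<forall>\<^sub>F h in at 0. \<bar>h\<bar> < \<delta> / 2"
      using \<delta> by (intro order_tendstoD(2)[of _ 0]) (auto intro!: tendsto_eq_intros)
    moreover have "\<forall>\<^sub>F h in at 0. h \<noteq> (0 :: real)"
      by (simp add: eventually_at_filter)
    ultimately show "\<forall>\<^sub>F h in at 0. norm ((\<phi> (0 + h) - \<phi> 0) / h - expectation X) \<le> C * \<bar>h\<bar>"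
    proof eventually_elim
      case (elim h)
      have "(\<phi> (0 + h) - \<phi> 0) / h - expectation X = (\<phi> h - 1 - h * expectation X) / h"
        using elim by (simp add: \<phi>0 field_simps)
      also have "\<bar>\<dots>\<bar> \<le> h\<^sup>2 * C / \<bar>h\<bar>"
        using quad[of h] elim by (simp add: divide_right_mono)
      also have "\<dots> = C * \<bar>h\<bar>"
        using elim by (simp add: power2_eq_square field_simps abs_mult_self_eq)
      finally show ?case by simp
    qed
  qed
  then have "((\<lambda>h. (\<phi> (0 + h) - \<phi> 0) / h) \<longlongrightarrow> expectation X) (at 0)"
    by (simp add: LIM_zero_iff)
  then show "((\<lambda>\<theta>. expectation (\<lambda>\<omega>. exp (\<theta> * X \<omega>))) has_real_derivative expectation X) (at 0)"
    by (simp add: DERIV_def \<phi>_def[abs_def])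
qed

text \<open>
  By Fubini, for almost every value \<open>y\<close> of \<open>Y\<close> the function \<open>exp (\<theta> * (x - y))\<close> is integrable in
  \<open>x\<close> under the law of \<open>X\<close>; one such \<open>y\<close> suffices, as it only contributes a constant factor.
\<close>

lemma (in prob_space) mgf_factor_integrable:
  fixes \<theta> :: real
  assumes indep: "indep_var borel X borel Y"
    and int: "integrable M (\<lambda>\<omega>. exp (\<theta> * (X \<omega> - Y \<omega>)))"
  shows "integrable M (\<lambda>\<omega>. exp (\<theta> * X \<omega>))" and "integrable M (\<lambda>\<omega>. exp (- \<theta> * Y \<omega>))"
proof -
  have [measurable]: "X \<in> borel_measurable M" "Y \<in> borel_measurable M"
    and eq: "distr M borel X \<Otimes>\<^sub>M distr M borel Y = distr M (borel \<Otimes>\<^sub>M borel) (\<lambda>x. (X x, Y x))"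
    using indep by (auto simp: indep_var_distribution_eq)
  interpret P: prob_space "distr M borel X" by (rule prob_space_distr) simp
  interpret Q: prob_space "distr M borel Y" by (rule prob_space_distr) simp
  interpret PQ: pair_prob_space "distr M borel X" "distr M borel Y" ..
  let ?f = "\<lambda>(x, y). exp (\<theta> * (x - y))"
  have [measurable]: "?f \<in> borel_measurable (borel \<Otimes>\<^sub>M borel)"
    unfolding case_prod_beta' by measurable
  have f: "integrable (distr M borel X \<Otimes>\<^sub>M distr M borel Y) ?f"
    unfolding eq by (subst integrable_distr_eq) (auto simp: int)
  have split: "exp (\<theta> * (x - y)) = exp (\<theta> * x) * exp (- \<theta> * y)" for x y :: real
    by (simp add: exp_add[symmetric] algebra_simps)
  have "AE y in distr M borel Y. integrable (distr M borel X) (\<lambda>x. exp (\<theta> * (x - y)))"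
    using PQ.AE_integrable_snd[OF f] .
  then obtain y where "integrable (distr M borel X) (\<lambda>x. exp (\<theta> * (x - y)))"
    using eventually_happens'[OF Q.ae_filter_bot] by blast
  then have "integrable (distr M borel X) (\<lambda>x. exp (\<theta> * x))"
    unfolding split by simp
  then show "integrable M (\<lambda>\<omega>. exp (\<theta> * X \<omega>))"
    by (subst (asm) integrable_distr_eq) auto
  have "AE x in distr M borel X. integrable (distr M borel Y) (\<lambda>y. exp (\<theta> * (x - y)))"
    using PQ.AE_integrable_fst'[OF f] by simp
  then obtain x where "integrable (distr M borel Y) (\<lambda>y. exp (\<theta> * (x - y)))"
    using eventually_happens'[OF P.ae_filter_bot] by blast
  then have "integrable (distr M borel Y) (\<lambda>y. exp (- \<theta> * y))"
    unfolding split by simp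
  then show "integrable M (\<lambda>\<omega>. exp (- \<theta> * Y \<omega>))"
    by (subst (asm) integrable_distr_eq) auto
qed

text \<open>
  If the mean vanished, so would \<open>X 1\<close>, hence all increments over unit intervals and, by
  monotonicity, the whole path.
\<close>

lemma subordinator_mean_pos:
  assumes X: "subordinator M X" and nn: "non_null M X" and int: "integrable M (X 1)"
  shows "0 < (\<integral>\<omega>. X 1 \<omega> \<partial>M)"
proof (rule ccontr)
  assume neg: "\<not> 0 < (\<integral>\<omega>. X 1 \<omega> \<partial>M)"
  interpret prob_space M by (rule subordinatorD(1)[OF X])
  have [measurable]: "X (real i) \<in> borel_measurable M" "X 1 \<in> borel_measurable M" for i
    using subordinatorD(2)[OF X] by simp_all
  have nonneg: "AE \<omega> in M. 0 \<le> X 1 \<omega>" using subordinator_nonneg[OF X] by eventually_elim simp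
  then have "(\<integral>\<omega>. X 1 \<omega> \<partial>M) = 0" using neg integral_nonneg_AE[OF nonneg] by simp
  then have X1: "AE \<omega> in M. X 1 \<omega> = 0"
    using integral_nonneg_eq_0_iff_AE[OF int nonneg] by simp
  have "AE \<omega> in M. X (real i + 1) \<omega> - X (real i) \<omega> = 0" for i
  proof -
    have [measurable]: "(\<lambda>\<omega>. X (real i + 1) \<omega> - X (real i) \<omega>) \<in> borel_measurable M"
      using subordinatorD(2)[OF X] by simp
    have "AE x in distr M borel (X 1). x = 0" using X1 by (subst AE_distr_iff) auto
    moreover have "distr M borel (\<lambda>\<omega>. X (real i + 1) \<omega> - X (real i) \<omega>) = distr M borel (X 1)"
      using subordinatorD(7)[OF X] unfolding stationary_increments_def by auto
    ultimately have "AE x in distr M borel (\<lambda>\<omega>. X (real i + 1) \<omega> - X (real i) \<omega>). x = 0"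
      by (simp only:)
    then show ?thesis by (subst (asm) AE_distr_iff) auto
  qed
  then have "AE \<omega> in M. \<forall>i::nat. X (real i + 1) \<omega> - X (real i) \<omega> = 0"
    by (simp add: AE_all_countable)
  then have "AE \<omega> in M. \<forall>t\<ge>0. X t \<omega> = 0"
    using subordinatorD(3,4)[OF X]
  proof eventually_elim
    case (elim \<omega>)
    have zero: "X (real i) \<omega> = 0" for i
      by (induction i) (use elim(1,2) in \<open>auto simp: add.commute\<close>)
    show ?case
    proof (intro allI impI)
      fix t :: real assume t: "0 \<le> t"
      obtain n :: nat where n: "t \<le> real n" using real_arch_simple by blast
      have "X 0 \<omega> \<le> X t \<omega>" "X t \<omega> \<le> X (real n) \<omega>"
        using mono_onD[OF elim(3), of 0 t] mono_onD[OF elim(3), of t "real n"] t n by auto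
      then show "X t \<omega> = 0" using zero elim(2) by simp
    qed
  qed
  then show False using nn by (simp add: non_null_def)
qed

lemma exp_kappa:
  assumes "prob_space M" "integrable M (\<lambda>\<omega>. exp (\<theta> * X 1 \<omega>))"
  shows "(\<integral>\<omega>. exp (\<theta> * X 1 \<omega>) \<partial>M) = exp (kappa M X \<theta>)"
proof -
  interpret prob_space M by fact
  have "(\<integral>\<omega>. exp (\<theta> * X 1 \<omega>) \<partial>M) \<noteq> 0"
    using integral_nonneg_eq_0_iff_AE[OF assms(2)] by simp
  moreover have "0 \<le> (\<integral>\<omega>. exp (\<theta> * X 1 \<omega>) \<partial>M)" by simp
  ultimately have "0 < (\<integral>\<omega>. exp (\<theta> * X 1 \<omega>) \<partial>M)" by linarith
  then show ?thesis by (simp add: kappa_def)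
qed

section \<open>Law of large numbers with exponential rates\<close>

text \<open>
  At integer times the moment generating function is a power of that of \<open>X 1\<close>. Rounding a real
  time \<open>u\<close> to a neighbouring integer costs the bounded factor \<open>exp \<bar>kappa M X \<theta>\<bar>\<close>. Multiplying the
  inequality by \<open>\<theta>\<close>, of either sign, covers both tails at once.
\<close>

lemma subordinator_chernoff_near_integer:
  assumes X: "subordinator M X" and int: "integrable M (\<lambda>\<omega>. exp (\<theta> * X 1 \<omega>))"
    and n: "\<bar>real n - u\<bar> \<le> 1"
  shows "measure M {\<omega> \<in> space M. \<theta> * r * u \<le> \<theta> * X (real n) \<omega>}
    \<le> exp (- (u * (\<theta> * r - kappa M X \<theta>)) + \<bar>kappa M X \<theta>\<bar>)"
proof -
  interpret prob_space M by (rule subordinatorD(1)[OF X])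
  let ?k = "kappa M X \<theta>"
  have [measurable]: "X (real n) \<in> borel_measurable M" using subordinatorD(2)[OF X] by simp
  note mgf = integer_time_mgf[OF subordinatorD(8)[OF X] int, of n]
  have "prob {\<omega> \<in> space M. \<theta> * r * u \<le> \<theta> * X (real n) \<omega>}
      = prob {\<omega> \<in> space M. exp (\<theta> * X (real n) \<omega>) \<ge> exp (\<theta> * r * u)}"
    by simp
  also have "\<dots> \<le> expectation (\<lambda>\<omega>. exp (\<theta> * X (real n) \<omega>)) / exp (\<theta> * r * u)"
    using mgf(1) by (intro integral_Markov_inequality_measure[where A = "space M"]) auto
  also have "\<dots> = exp (real n * ?k - \<theta> * r * u)"
    unfolding mgf(2) exp_kappa[where X = X, OF prob_space_axioms int]
    by (simp add: exp_diff exp_of_nat_mult)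
  also have "real n * ?k = u * ?k + (real n - u) * ?k" by (simp add: algebra_simps)
  also have "(real n - u) * ?k \<le> \<bar>?k\<bar>"
    using mult_right_mono[OF n, of "\<bar>?k\<bar>"] by (simp add: abs_mult[symmetric])
  finally show ?thesis by (simp add: algebra_simps)
qed

lemma exp_linear_absorb_eventually:
  assumes "0 < (g :: real)"
  shows "\<forall>\<^sub>F u in at_top. exp (- (u * g) + K) \<le> exp (- (g / 2 * u))"
proof -
  have "\<forall>\<^sub>F u in at_top. K / (g / 2) \<le> (u :: real)" by (rule eventually_ge_at_top)
  then show ?thesis by eventually_elim (use assms in \<open>simp add: field_simps\<close>)
qed

text \<open>
  As \<open>kappa M X 0 = 0\<close> and the slope of \<open>kappa M X\<close> at \<open>0\<close> is \<open>m < r\<close>, the exponent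
  \<open>\<theta> * r - kappa M X \<theta>\<close> is positive for small \<open>\<theta> > 0\<close>. Rounding \<open>u\<close> up increases \<open>X u\<close>.
\<close>

lemma subordinator_upper_tail:
  assumes X: "subordinator M X"
    and \<delta>: "0 < \<delta>" and int: "\<And>\<theta>. \<bar>\<theta>\<bar> < \<delta> \<Longrightarrow> integrable M (\<lambda>\<omega>. exp (\<theta> * X 1 \<omega>))"
    and der: "(kappa M X has_real_derivative m) (at 0)" and r: "m < r"
  shows "\<exists>k>0. \<forall>\<^sub>F u in at_top. measure M {\<omega> \<in> space M. r * u \<le> X u \<omega>} \<le> exp (- (k * u))"
proof -
  interpret prob_space M by (rule subordinatorD(1)[OF X])
  have k0: "kappa M X 0 = 0" by (simp add: kappa_def prob_space)
  have "((\<lambda>\<theta>. \<theta> * r - kappa M X \<theta>) has_real_derivative r - m) (at 0)"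
    using der by (auto intro!: derivative_eq_intros)
  from DERIV_pos_inc_right[OF this] r obtain d where d: "0 < d"
    "\<And>h. 0 < h \<Longrightarrow> h < d \<Longrightarrow> 0 < h * r - kappa M X h"
    by (auto simp: k0)
  define \<theta> where "\<theta> = min d \<delta> / 2"
  have \<theta>: "0 < \<theta>" "\<theta> < d" "\<bar>\<theta>\<bar> < \<delta>" using d \<delta> by (auto simp: \<theta>_def)
  define g where "g = \<theta> * r - kappa M X \<theta>"
  have g: "0 < g" using d \<theta> by (simp add: g_def)
  have "\<forall>\<^sub>F u in at_top. measure M {\<omega> \<in> space M. r * u \<le> X u \<omega>} \<le> exp (- (g / 2 * u))"
    using exp_linear_absorb_eventually[OF g, of "\<bar>kappa M X \<theta>\<bar>"] eventually_ge_at_top[of 0]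
  proof eventually_elim
    case (elim u)
    define n where "n = nat \<lceil>u\<rceil>"
    have n: "u \<le> real n" "\<bar>real n - u\<bar> \<le> 1" using elim(2) unfolding n_def by linarith+
    have [measurable]: "X (real n) \<in> borel_measurable M" using subordinatorD(2)[OF X] by simp
    have "prob {\<omega> \<in> space M. r * u \<le> X u \<omega>} \<le> prob {\<omega> \<in> space M. \<theta> * r * u \<le> \<theta> * X (real n) \<omega>}"
    proof (rule finite_measure_mono_AE)
      show "AE \<omega> in M. \<omega> \<in> {\<omega> \<in> space M. r * u \<le> X u \<omega>}
          \<longrightarrow> \<omega> \<in> {\<omega> \<in> space M. \<theta> * r * u \<le> \<theta> * X (real n) \<omega>}"
        using subordinatorD(4)[OF X]
      proof eventually_elim
        case (elim \<omega>)
        have "X u \<omega> \<le> X (real n) \<omega>"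
          using mono_onD[OF elim, of u "real n"] n \<open>0 \<le> u\<close> by simp
        then show ?case using \<theta>(1) by (auto simp: mult.assoc intro!: mult_left_mono)
      qed
    qed measurable
    also have "\<dots> \<le> exp (- (u * g) + \<bar>kappa M X \<theta>\<bar>)"
      unfolding g_def by (rule subordinator_chernoff_near_integer[OF X int[OF \<theta>(3)] n(2)])
    finally show ?case using elim(1) by (rule order_trans)
  qed
  then show ?thesis using g by (intro exI[of _ "g / 2"]) auto
qed

text \<open>
  The mirror image of the upper tail, with small \<open>\<theta> < 0\<close> and \<open>u\<close> rounded down.
\<close>

lemma subordinator_lower_tail:
  assumes X: "subordinator M X"
    and \<delta>: "0 < \<delta>" and int: "\<And>\<theta>. \<bar>\<theta>\<bar> < \<delta> \<Longrightarrow> integrable M (\<lambda>\<omega>. exp (\<theta> * X 1 \<omega>))"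
    and der: "(kappa M X has_real_derivative m) (at 0)" and r: "r < m"
  shows "\<exists>k>0. \<forall>\<^sub>F u in at_top. measure M {\<omega> \<in> space M. X u \<omega> \<le> r * u} \<le> exp (- (k * u))"
proof -
  interpret prob_space M by (rule subordinatorD(1)[OF X])
  have k0: "kappa M X 0 = 0" by (simp add: kappa_def prob_space)
  have "((\<lambda>\<theta>. \<theta> * r - kappa M X \<theta>) has_real_derivative r - m) (at 0)"
    using der by (auto intro!: derivative_eq_intros)
  from DERIV_neg_dec_left[OF this] r obtain d where d: "0 < d"
    "\<And>h. 0 < h \<Longrightarrow> h < d \<Longrightarrow> 0 < - h * r - kappa M X (- h)"
    by (auto simp: k0)
  define \<theta> where "\<theta> = - (min d \<delta> / 2)"
  have \<theta>: "\<theta> < 0" "- \<theta> < d" "\<bar>\<theta>\<bar> < \<delta>" using d \<delta> by (auto simp: \<theta>_def)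
  define g where "g = \<theta> * r - kappa M X \<theta>"
  have g: "0 < g" using d(2)[of "- \<theta>"] \<theta> by (simp add: g_def)
  have "\<forall>\<^sub>F u in at_top. measure M {\<omega> \<in> space M. X u \<omega> \<le> r * u} \<le> exp (- (g / 2 * u))"
    using exp_linear_absorb_eventually[OF g, of "\<bar>kappa M X \<theta>\<bar>"] eventually_ge_at_top[of 0]
  proof eventually_elim
    case (elim u)
    define n where "n = nat \<lfloor>u\<rfloor>"
    have n: "real n \<le> u" "\<bar>real n - u\<bar> \<le> 1" using elim(2) unfolding n_def by linarith+
    have [measurable]: "X (real n) \<in> borel_measurable M" using subordinatorD(2)[OF X] by simp
    have "prob {\<omega> \<in> space M. X u \<omega> \<le> r * u} \<le> prob {\<omega> \<in> space M. \<theta> * r * u \<le> \<theta> * X (real n) \<omega>}"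
    proof (rule finite_measure_mono_AE)
      show "AE \<omega> in M. \<omega> \<in> {\<omega> \<in> space M. X u \<omega> \<le> r * u}
          \<longrightarrow> \<omega> \<in> {\<omega> \<in> space M. \<theta> * r * u \<le> \<theta> * X (real n) \<omega>}"
        using subordinatorD(4)[OF X]
      proof eventually_elim
        case (elim \<omega>)
        have "X (real n) \<omega> \<le> X u \<omega>"
          using mono_onD[OF elim, of "real n" u] n \<open>0 \<le> u\<close> by simp
        then show ?case using \<theta>(1) by (auto simp: mult.assoc intro!: mult_left_mono_neg)
      qed
    qed measurable
    also have "\<dots> \<le> exp (- (u * g) + \<bar>kappa M X \<theta>\<bar>)"
      unfolding g_def by (rule subordinator_chernoff_near_integer[OF X int[OF \<theta>(3)] n(2)])
    finally show ?case using elim(1) by (rule order_trans)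
  qed
  then show ?thesis using g by (intro exI[of _ "g / 2"]) auto
qed

lemma subordinator_kappa_derivative:
  assumes X: "subordinator M X" and nn: "non_null M X" and fin: "kappa_finite_near_0 M X"
  shows "(kappa M X has_real_derivative deriv (kappa M X) 0) (at 0)" and "0 < deriv (kappa M X) 0"
proof -
  interpret prob_space M by (rule subordinatorD(1)[OF X])
  obtain \<delta> where \<delta>: "0 < \<delta>" "\<And>\<theta>. \<bar>\<theta>\<bar> < \<delta> \<Longrightarrow> integrable M (\<lambda>\<omega>. exp (\<theta> * X 1 \<omega>))"
    using fin unfolding kappa_finite_near_0_def by blast
  have meas: "X 1 \<in> borel_measurable M" using subordinatorD(2)[OF X] by simp
  have nonneg: "AE \<omega> in M. 0 \<le> X 1 \<omega>" using subordinator_nonneg[OF X] by eventually_elim simp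
  have "0 < \<delta> / 2" "integrable M (\<lambda>\<omega>. exp (\<delta> / 2 * X 1 \<omega>))"
    using \<delta>(1) \<delta>(2)[of "\<delta> / 2"] by simp_all
  note mgf = mgf_has_derivative_at_0[OF meas nonneg this]
  have "(kappa M X has_real_derivative
      1 / expectation (\<lambda>\<omega>. exp (0 * X 1 \<omega>)) * expectation (X 1)) (at 0)"
    unfolding kappa_def[abs_def]
    by (rule DERIV_chain2[OF _ mgf(2)], rule DERIV_ln_divide) (simp add: prob_space)
  then have der: "(kappa M X has_real_derivative expectation (X 1)) (at 0)"
    by (simp add: prob_space)
  then have "deriv (kappa M X) 0 = expectation (X 1)" by (rule DERIV_imp_deriv)
  with der subordinator_mean_pos[OF X nn mgf(1)]
  show "(kappa M X has_real_derivative deriv (kappa M X) 0) (at 0)" "0 < deriv (kappa M X) 0"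
    by simp_all
qed

section \<open>Measurability of the time change\<close>

lemma borel_measurable_completion_AE:
  fixes f g :: "'a \<Rightarrow> 'b :: topological_space"
  assumes f: "f \<in> borel_measurable (completion M)" and ae: "AE \<omega> in M. f \<omega> = g \<omega>"
  shows "g \<in> borel_measurable (completion M)"
proof (rule measurableI)
  fix A :: "'b set" assume A: "A \<in> sets borel"
  have "AE \<omega> in completion M. f \<omega> = g \<omega>" using ae by (rule AE_completion)
  then have "AE \<omega> in completion M. \<omega> \<in> f -` A \<inter> space (completion M) \<longleftrightarrow> \<omega> \<in> g -` A \<inter> space (completion M)"
    by eventually_elim simp
  then show "g -` A \<inter> space (completion M) \<in> sets (completion M)"
    using measurable_sets[OF f A] by (rule completion.in_sets_AE) simp
qed simp

text \<open>
  Adding \<open>1\<close> after rounding down keeps the grid points strictly to the right of \<open>x\<close>, where right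
  continuity applies.
\<close>

lemma grid_right_approximation:
  fixes x :: real
  shows "filterlim (\<lambda>n. (real_of_int \<lfloor>real (Suc n) * x\<rfloor> + 1) / real (Suc n)) (at_right x) sequentially"
proof (rule tendsto_imp_filterlim_at_right)
  have up: "(real_of_int \<lfloor>real (Suc n) * x\<rfloor> + 1) / real (Suc n) \<le> x + 1 / real (Suc n)" for n
  proof -
    have "real_of_int \<lfloor>real (Suc n) * x\<rfloor> + 1 \<le> real (Suc n) * x + 1" by simp
    then have "(real_of_int \<lfloor>real (Suc n) * x\<rfloor> + 1) / real (Suc n) \<le> (real (Suc n) * x + 1) / real (Suc n)"
      by (intro divide_right_mono) auto
    also have "\<dots> = x + 1 / real (Suc n)" by (simp add: add_divide_distrib)
    finally show ?thesis .
  qed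
  have low: "x < (real_of_int \<lfloor>real (Suc n) * x\<rfloor> + 1) / real (Suc n)" for n
    using real_of_int_floor_add_one_gt[of "real (Suc n) * x"] 
    by (simp only: pos_less_divide_eq of_nat_0_less_iff zero_less_Suc mult.commute)
  show "\<forall>\<^sub>F n in sequentially. x < (real_of_int \<lfloor>real (Suc n) * x\<rfloor> + 1) / real (Suc n)"
    using low by simp
  have lim: "(\<lambda>n. x + 1 / real (Suc n)) \<longlonglongrightarrow> x"
    using tendsto_add[OF tendsto_const[of x] LIMSEQ_Suc[OF lim_1_over_n]] by simp
  show "(\<lambda>n. (real_of_int \<lfloor>real (Suc n) * x\<rfloor> + 1) / real (Suc n)) \<longlonglongrightarrow> x"
    by (rule tendsto_sandwich[OF _ _ tendsto_const lim])
      (use low up in \<open>auto simp: less_imp_le intro!: always_eventually\<close>)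
qed

text \<open>
  Approximating the random time from the right by random times with countably many values shows that
  \<open>X (T \<omega>) \<omega>\<close> agrees almost everywhere with a limit of measurable functions. The exceptional
  null set, on which the path need not be right continuous, is what makes the completion necessary.
\<close>

lemma time_change_measurable:
  assumes X: "levy_process M X" and T[measurable]: "T \<in> borel_measurable M"
    and nonneg: "AE \<omega> in M. 0 \<le> T \<omega>"
  shows "(\<lambda>\<omega>. X (T \<omega>) \<omega>) \<in> borel_measurable (completion M)"
proof -
  define \<tau> where "\<tau> n \<omega> = (real_of_int \<lfloor>real (Suc n) * max 0 (T \<omega>)\<rfloor> + 1) / real (Suc n)" for n \<omega>
  have meas: "(\<lambda>\<omega>. X (\<tau> n \<omega>) \<omega>) \<in> borel_measurable M" for n
  proof -
    have "X ((real k + 1) / real (Suc n)) \<in> borel_measurable M" for k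
      using X unfolding levy_process_def by simp
    then have "(\<lambda>\<omega>. X ((real (nat \<lfloor>real (Suc n) * max 0 (T \<omega>)\<rfloor>) + 1) / real (Suc n)) \<omega>) \<in> borel_measurable M"
      by (rule measurable_compose_countable) measurable
    moreover have "real (nat \<lfloor>real (Suc n) * max 0 (T \<omega>)\<rfloor>) = real_of_int \<lfloor>real (Suc n) * max 0 (T \<omega>)\<rfloor>" for \<omega>
      by simp
    ultimately show ?thesis unfolding \<tau>_def by (simp only:)
  qed
  have "(\<lambda>\<omega>. lim (\<lambda>n. X (\<tau> n \<omega>) \<omega>)) \<in> borel_measurable M"
    using meas by (rule borel_measurable_lim_metric)
  then have "(\<lambda>\<omega>. lim (\<lambda>n. X (\<tau> n \<omega>) \<omega>)) \<in> borel_measurable (completion M)"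
    by (rule measurable_completion)
  moreover have "AE \<omega> in M. lim (\<lambda>n. X (\<tau> n \<omega>) \<omega>) = X (T \<omega>) \<omega>"
  proof -
    have "AE \<omega> in M. cadlag (\<lambda>t. X t \<omega>)" using X by (simp add: levy_process_def)
    then show ?thesis using nonneg
    proof eventually_elim
      case (elim \<omega>)
      have "((\<lambda>t. X t \<omega>) \<longlongrightarrow> X (T \<omega>) \<omega>) (at_right (T \<omega>))"
        using elim by (simp add: cadlag_def)
      moreover have "filterlim (\<lambda>n. \<tau> n \<omega>) (at_right (T \<omega>)) sequentially"
        using grid_right_approximation[of "T \<omega>"] elim(2) by (simp add: \<tau>_def max_absorb2)
      ultimately have "(\<lambda>n. X (\<tau> n \<omega>) \<omega>) \<longlonglongrightarrow> X (T \<omega>) \<omega>" by (rule filterlim_compose)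
      then show ?case by (rule limI)
    qed
  qed
  ultimately show ?thesis by (rule borel_measurable_completion_AE)
qed

lemma inverse_stable_subordinator_nonneg:
  assumes L: "inverse_stable_subordinator \<nu> M L" and t: "0 \<le> t"
  shows "AE \<omega> in M. 0 \<le> L t \<omega>"
  using inverse_stable_subordinator_duality[OF L] t by (auto elim: eventually_mono)

lemma time_changed_subordinator_measurable:
  assumes "subordinator M X" "inverse_stable_subordinator \<nu> M L" "0 \<le> t"
  shows "(\<lambda>\<omega>. X (L t \<omega>) \<omega>) \<in> borel_measurable (completion M)"
proof (rule time_change_measurable[OF subordinatorD(8)[OF assms(1)]])
  show "L t \<in> borel_measurable M" using assms by (simp add: inverse_stable_subordinator_def)
qed (rule inverse_stable_subordinator_nonneg[OF assms(2,3)])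

section \<open>Tails of the time-changed difference\<close>

lemma (in prob_space) indep_var_sym:
  assumes "indep_var S X T Y"
  shows "indep_var T Y S X"
  using assms unfolding indep_var_eq indep_sets2_eq
  by (intro conjI ballI) (blast, blast, blast, blast, subst Int_commute, subst mult.commute, blast)

lemma (in prob_space) indep_pairs_prob_factorizes:
  assumes xy: "indep_var (borel \<Otimes>\<^sub>M borel) (\<lambda>\<omega>. (X \<omega>, Y \<omega>)) (borel \<Otimes>\<^sub>M borel) (\<lambda>\<omega>. (L \<omega>, K \<omega>))"
    and lk: "indep_var borel L borel K"
    and sets[measurable]: "A \<in> sets (borel \<Otimes>\<^sub>M borel)" "B \<in> sets borel" "C \<in> sets borel"
  shows "prob {\<omega> \<in> space M. (X \<omega>, Y \<omega>) \<in> A \<and> L \<omega> \<in> B \<and> K \<omega> \<in> C}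
    = prob {\<omega> \<in> space M. (X \<omega>, Y \<omega>) \<in> A} * (prob {\<omega> \<in> space M. L \<omega> \<in> B} * prob {\<omega> \<in> space M. K \<omega> \<in> C})"
proof -
  have "{\<omega> \<in> space M. (X \<omega>, Y \<omega>) \<in> A \<and> L \<omega> \<in> B \<and> K \<omega> \<in> C}
      = (\<lambda>\<omega>. ((X \<omega>, Y \<omega>), (L \<omega>, K \<omega>))) -` (A \<times> (B \<times> C)) \<inter> space M" by auto
  then have "prob {\<omega> \<in> space M. (X \<omega>, Y \<omega>) \<in> A \<and> L \<omega> \<in> B \<and> K \<omega> \<in> C}
      = prob ((\<lambda>\<omega>. (X \<omega>, Y \<omega>)) -` A \<inter> space M) * prob ((\<lambda>\<omega>. (L \<omega>, K \<omega>)) -` (B \<times> C) \<inter> space M)"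
    using indep_varD[OF xy, of A "B \<times> C"] by simp
  also have "prob ((\<lambda>\<omega>. (L \<omega>, K \<omega>)) -` (B \<times> C) \<inter> space M)
      = prob (L -` B \<inter> space M) * prob (K -` C \<inter> space M)"
    using indep_varD[OF lk, of B C] by simp
  finally show ?thesis
    by (simp add: vimage_def Int_def conj_commute)
qed

lemma filterlim_linear_scale:
  fixes s :: "real \<Rightarrow> real"
  assumes "0 < (z :: real)" "filterlim s at_top F"
  shows "filterlim (\<lambda>t. z * s t) at_top F"
  by (rule filterlim_tendsto_pos_mult_at_top[OF tendsto_const assms])

text \<open>
  The estimate on which the theorem rests. Independence of the processes at
  fixed times gives the lower bound; monotonicity of the paths transfers the conclusion to the random times.
\<close>

lemma time_changed_difference_right_tail:
  fixes \<nu> :: real and M :: "'a measure" and X Y L K :: "real \<Rightarrow> 'a \<Rightarrow> real" and a :: "real \<Rightarrow> real"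
  defines "s \<equiv> \<lambda>t. (a t * t) powr \<nu> / a t"
  defines "Z \<equiv> \<lambda>t \<omega>. (X (L t \<omega>) \<omega> - Y (K t \<omega>) \<omega>) / s t"
  assumes \<nu>: "0 < \<nu>" "\<nu> < 1"
    and X: "subordinator M X" "non_null M X" "kappa_finite_near_0 M X"
    and Y: "subordinator M Y" "non_null M Y" "kappa_finite_near_0 M Y"
    and L: "inverse_stable_subordinator \<nu> M L" and K: "inverse_stable_subordinator \<nu> M K"
    and indep_LK: "\<And>t. 0 \<le> t \<Longrightarrow> prob_space.indep_var M borel (L t) borel (K t)"
    and indep_XY_LK: "\<And>t u w. 0 \<le> t \<Longrightarrow> 0 \<le> u \<Longrightarrow> 0 \<le> w \<Longrightarrow> prob_space.indep_var M
      (borel \<Otimes>\<^sub>M borel) (\<lambda>\<omega>. (X u \<omega>, Y w \<omega>)) (borel \<Otimes>\<^sub>M borel) (\<lambda>\<omega>. (L t \<omega>, K t \<omega>))"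
    and a: "\<And>t. 0 < t \<Longrightarrow> 0 < a t" "(a \<longlongrightarrow> 0) at_top" "filterlim (\<lambda>t. a t * t) at_top at_top"
  shows "right_tail_decay (completion M) Z (\<lambda>t. 1 / a t)
    (\<lambda>x. stable_rate \<nu> (x / deriv (kappa M X) 0))"
proof -
  define m where "m = deriv (kappa M X) 0"
  define m' where "m' = deriv (kappa M Y) 0"
  interpret prob_space M by (rule subordinatorD(1)[OF X(1)])
  interpret compl: prob_space "completion M" by (rule prob_space_completion)
  have m: "(kappa M X has_real_derivative m) (at 0)" "0 < m"
    and m': "(kappa M Y has_real_derivative m') (at 0)" "0 < m'"
    using subordinator_kappa_derivative[OF X] subordinator_kappa_derivative[OF Y]
    by (auto simp: m_def m'_def)
  obtain \<delta>X where \<delta>X: "0 < \<delta>X" "\<And>\<theta>. \<bar>\<theta>\<bar> < \<delta>X \<Longrightarrow> integrable M (\<lambda>\<omega>. exp (\<theta> * X 1 \<omega>))"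
    using X(3) unfolding kappa_finite_near_0_def by blast
  obtain \<delta>Y where \<delta>Y: "0 < \<delta>Y" "\<And>\<theta>. \<bar>\<theta>\<bar> < \<delta>Y \<Longrightarrow> integrable M (\<lambda>\<omega>. exp (\<theta> * Y 1 \<omega>))"
    using Y(3) unfolding kappa_finite_near_0_def by blast
  have Xm: "\<And>u. 0 \<le> u \<Longrightarrow> X u \<in> borel_measurable M" and Ym: "\<And>u. 0 \<le> u \<Longrightarrow> Y u \<in> borel_measurable M"
    using subordinatorD(2) X(1) Y(1) by blast+
  have Lm: "\<And>t. 0 \<le> t \<Longrightarrow> L t \<in> borel_measurable M" and Km: "\<And>t. 0 \<le> t \<Longrightarrow> K t \<in> borel_measurable M"
    using L K by (auto simp: inverse_stable_subordinator_def)
  note L0 = inverse_stable_subordinator_nonneg[OF L] and K0 = inverse_stable_subordinator_nonneg[OF K]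
  have Zm: "Z t \<in> borel_measurable (completion M)" if "0 < t" for t
    unfolding Z_def
    by (intro borel_measurable_divide borel_measurable_diff borel_measurable_const
        time_changed_subordinator_measurable[OF X(1) L] time_changed_subordinator_measurable[OF Y(1) K]) (use that in auto)

  have apos: "\<forall>\<^sub>F t in at_top. 0 < a t"
    using eventually_gt_at_top[of 0] by eventually_elim (rule a)
  have v: "filterlim (\<lambda>t. 1 / a t) at_top at_top"
  proof -
    have "filterlim a (at_right 0) at_top"
      using a(2) apos by (rule tendsto_imp_filterlim_at_right)
    then show ?thesis
      by (simp add: divide_inverse filterlim_compose[OF filterlim_inverse_at_top_right])
  qed
  have as: "filterlim (\<lambda>t. (a t * t) powr \<nu>) at_top at_top"
  proof (rule filterlim_compose[OF _ a(3)])
    have "filterlim (\<lambda>x::real. exp (\<nu> * ln x)) at_top at_top"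
      by (intro filterlim_compose[OF exp_at_top] filterlim_linear_scale[OF \<nu>(1) ln_at_top])
    moreover have "\<forall>\<^sub>F x in at_top. exp (\<nu> * ln x) = (x :: real) powr \<nu>"
      using eventually_gt_at_top[of 0] by eventually_elim (simp add: powr_def)
    ultimately show "filterlim (\<lambda>x::real. x powr \<nu>) at_top at_top"
      by (rule filterlim_cong[THEN iffD1, OF refl refl, rotated])
  qed
  have s: "filterlim s at_top at_top"
    unfolding s_def using filterlim_at_top_mult_at_top[OF as v] by simp
  have spos: "0 < s t" if "0 < t" for t
    using a(1)[OF that] that by (simp add: s_def)

  have upper: "\<forall>\<^sub>F t in at_top. measure (completion M) {\<omega> \<in> space (completion M). x \<le> Z t \<omega>}
      \<le> exp (- (1 / a t * (stable_rate \<nu> (x / m) - \<epsilon>)))" if x: "0 < x" and \<epsilon>: "0 < \<epsilon>" for x \<epsilon>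
  proof -
    have xm: "0 < x / m" using x m by simp
    have "(stable_rate \<nu> \<longlongrightarrow> stable_rate \<nu> (x / m)) (at_left (x / m))"
      using continuous_stable_rate[OF \<nu>(2) xm] by (simp add: isCont_def filterlim_at_split)
    then have "\<forall>\<^sub>F z in at_left (x / m). stable_rate \<nu> (x / m) - \<epsilon> < stable_rate \<nu> z"
      using \<epsilon> by (intro order_tendstoD(1)) auto
    moreover have "\<forall>\<^sub>F z in at_left (x / m). z \<in> {0<..<x / m}"
      using xm by (rule eventually_at_left_real)
    ultimately have "\<forall>\<^sub>F z in at_left (x / m). stable_rate \<nu> (x / m) - \<epsilon> < stable_rate \<nu> z \<and> z \<in> {0<..<x / m}"
      by (rule eventually_conj)
    then obtain z where z: "stable_rate \<nu> (x / m) - \<epsilon> < stable_rate \<nu> z" "0 < z" "z < x / m"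
      using eventually_happens'[OF trivial_limit_at_left_real] by force
    have "m < x / z" using z m by (simp add: field_simps)
    from subordinator_upper_tail[OF X(1) \<delta>X m(1) this]
    obtain k where k: "0 < k" "\<forall>\<^sub>F u in at_top. prob {\<omega> \<in> space M. x / z * u \<le> X u \<omega>} \<le> exp (- (k * u))"
      by blast
    have "\<forall>\<^sub>F t in at_top. prob {\<omega> \<in> space M. x / z * (z * s t) \<le> X (z * s t) \<omega>} \<le> exp (- (k * (z * s t)))"
      using filterlim_linear_scale[OF z(2) s] k(2) by (rule eventually_compose_filterlim[rotated])
    moreover have "\<forall>\<^sub>F t in at_top. stable_rate \<nu> z / (k * z) \<le> (a t * t) powr \<nu>"
      using as by (simp add: filterlim_at_top)
    moreover have "\<forall>\<^sub>F t in at_top. 2 * exp (- (1 / a t * stable_rate \<nu> z))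
        \<le> exp (- (1 / a t * (stable_rate \<nu> (x / m) - \<epsilon>)))"
      using v z(1) by (rule two_exp_le_exp_eventually)
    ultimately show ?thesis using eventually_gt_at_top[of 0]
    proof eventually_elim
      case (elim t)
      define u where "u = z * s t"
      have u: "0 \<le> u" using z spos[OF elim(4)] by (simp add: u_def)
      note at = a(1)[OF elim(4)]
      note [measurable] = Xm[OF u] Lm[OF less_imp_le[OF elim(4)]]
      let ?A = "{\<omega> \<in> space M. u < L t \<omega>}" and ?B = "{\<omega> \<in> space M. x * s t \<le> X u \<omega>}"
      \<comment> \<open>decay at rate \<open>s t\<close>, and \<open>a t * s t\<close> tends to infinity, hence faster than any \<open>exp (- c / a t)\<close>\<close>
      have B: "prob ?B \<le> exp (- (1 / a t * stable_rate \<nu> z))"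
      proof -
        have "prob ?B \<le> exp (- (k * u))" using elim(1) z by (simp add: u_def)
        also have "stable_rate \<nu> z \<le> k * z * (a t * t) powr \<nu>"
          using elim(2) k z by (simp add: field_simps)
        then have "1 / a t * stable_rate \<nu> z \<le> 1 / a t * (k * z * (a t * t) powr \<nu>)"
          using at by (intro mult_left_mono) auto
        then have "exp (- (k * u)) \<le> exp (- (1 / a t * stable_rate \<nu> z))"
          by (simp add: u_def s_def field_simps)
        finally show ?thesis .
      qed
      have A: "prob ?A \<le> exp (- (1 / a t * stable_rate \<nu> z))"
        unfolding u_def s_def using inverse_stable_upper_tail_le[OF \<nu> L z(2) elim(4) at] .
      have "AE \<omega> in M. x \<le> Z t \<omega> \<longrightarrow> u < L t \<omega> \<or> x * s t \<le> X u \<omega>"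
        using subordinatorD(4)[OF X(1)] subordinator_nonneg[OF Y(1)]
          L0[OF less_imp_le[OF elim(4)]] K0[OF less_imp_le[OF elim(4)]]
      proof eventually_elim
        case (elim \<omega>)
        show ?case
        proof (intro impI)
          assume "x \<le> Z t \<omega>"
          then have "x * s t \<le> X (L t \<omega>) \<omega> - Y (K t \<omega>) \<omega>"
            using spos[OF \<open>0 < t\<close>] by (simp add: Z_def pos_le_divide_eq)
          then have "x * s t \<le> X (L t \<omega>) \<omega>" using elim(2,4) by force
          moreover have "X (L t \<omega>) \<omega> \<le> X u \<omega>" if "L t \<omega> \<le> u"
            using mono_onD[OF elim(1) _ _ that] elim(3) u by simp
          ultimately show "u < L t \<omega> \<or> x * s t \<le> X u \<omega>" by linarith
        qed
      qed
      then have "AE \<omega> in completion M. x \<le> Z t \<omega> \<longrightarrow> u < L t \<omega> \<or> x * s t \<le> X u \<omega>"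
        by (rule AE_completion)
      then have "measure (completion M) {\<omega> \<in> space (completion M). x \<le> Z t \<omega>} \<le> measure (completion M) (?A \<union> ?B)"
        by (intro compl.finite_measure_mono_AE) (auto elim: eventually_mono)
      also have "\<dots> = prob (?A \<union> ?B)" by (rule measure_completion) measurable
      also have "\<dots> \<le> prob ?A + prob ?B" by (rule measure_Un_le) measurable
      finally show ?case using A B elim(3) by linarith
    qed
  qed

  have lower: "\<forall>\<^sub>F t in at_top. exp (- (1 / a t * (stable_rate \<nu> (x / m) + \<epsilon>)))
      \<le> measure (completion M) {\<omega> \<in> space (completion M). x < Z t \<omega>}" if x: "0 < x" and \<epsilon>: "0 < \<epsilon>" for x \<epsilon>
  proof -
    have xm: "0 < x / m" using x m by simp
    have "(stable_rate \<nu> \<longlongrightarrow> stable_rate \<nu> (x / m)) (at_right (x / m))"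
      using continuous_stable_rate[OF \<nu>(2) xm] by (simp add: isCont_def filterlim_at_split)
    then have "\<forall>\<^sub>F z in at_right (x / m). stable_rate \<nu> z < stable_rate \<nu> (x / m) + \<epsilon> / 2"
      using \<epsilon> by (intro order_tendstoD(2)) auto
    moreover have "\<forall>\<^sub>F z in at_right (x / m). x / m < z" by (rule eventually_at_right_less)
    ultimately have "\<forall>\<^sub>F z in at_right (x / m). stable_rate \<nu> z < stable_rate \<nu> (x / m) + \<epsilon> / 2 \<and> x / m < z"
      by (rule eventually_conj)
    then obtain z where z: "stable_rate \<nu> z < stable_rate \<nu> (x / m) + \<epsilon> / 2" "x / m < z"
      using eventually_happens'[OF trivial_limit_at_right_real] by blast
    have z0: "0 < z" using z(2) xm by linarith
    \<comment> \<open>\<open>X\<close> at time \<open>z * s t\<close> probably exceeds \<open>r * (z * s t)\<close>, which leaves the surplus \<open>(r * z - x) * s t\<close>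
      for the subtracted term; \<open>\<eta>\<close> is chosen such that \<open>Y\<close> at time \<open>\<eta> * s t\<close>, being probably below
      \<open>q * (\<eta> * s t)\<close>, does not use up more\<close>
    define r where "r = (x / z + m) / 2"
    have r: "r < m" "x < r * z" using z z0 m by (auto simp: r_def field_simps)
    define q where "q = m' + 1"
    define \<eta> where "\<eta> = (r * z - x) / q"
    have \<eta>: "0 < \<eta>" "q * \<eta> = r * z - x" using r m' by (auto simp: \<eta>_def q_def)
    obtain k where k: "0 < k" "\<forall>\<^sub>F u in at_top. prob {\<omega> \<in> space M. X u \<omega> \<le> r * u} \<le> exp (- (k * u))"
      using subordinator_lower_tail[OF X(1) \<delta>X m(1) r(1)] by blast
    have "m' < q" by (simp add: q_def)
    from subordinator_upper_tail[OF Y(1) \<delta>Y m'(1) this]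
    obtain l where l: "0 < l" "\<forall>\<^sub>F w in at_top. prob {\<omega> \<in> space M. q * w \<le> Y w \<omega>} \<le> exp (- (l * w))"
      by blast
    have quarter: "\<forall>\<^sub>F t in at_top. exp (- (b * f t)) \<le> 1 / 4"
      if "0 < b" "filterlim f at_top at_top" for b :: real and f :: "real \<Rightarrow> real"
    proof -
      have "\<forall>\<^sub>F t in at_top. ln 4 / b \<le> f t" using that(2) by (simp add: filterlim_at_top)
      then show ?thesis
      proof eventually_elim
        case (elim t)
        then have "exp (- (b * f t)) \<le> exp (- ln 4)" using that(1) by (simp add: field_simps)
        then show ?case by (simp add: exp_minus)
      qed
    qed
    have sz: "filterlim (\<lambda>t. z * s t) at_top at_top" and s\<eta>: "filterlim (\<lambda>t. \<eta> * s t) at_top at_top"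
      using filterlim_linear_scale s z0 \<eta> by blast+
    have R\<eta>: "0 < stable_rate \<nu> \<eta>"
      using stable_rate_factor_pos[OF \<nu>] \<eta> by (simp add: stable_rate_def)
    have \<epsilon>4: "0 < \<epsilon> / 4" using \<epsilon> by simp
    obtain s0 where s0: "\<And>b t. 0 < t \<Longrightarrow> 0 < b \<Longrightarrow> s0 \<le> 1 / b \<Longrightarrow>
      exp (- (1 / b * (stable_rate \<nu> z + \<epsilon> / 4))) \<le> prob {\<omega> \<in> space M. z * ((b * t) powr \<nu> / b) < L t \<omega>}"
      using inverse_stable_upper_tail_ge[OF \<nu> L z0 \<epsilon>4] by blast
    have "\<forall>\<^sub>F t in at_top. s0 \<le> 1 / a t" using v by (simp add: filterlim_at_top)
    moreover have "\<forall>\<^sub>F t in at_top. prob {\<omega> \<in> space M. X (z * s t) \<omega> \<le> r * (z * s t)} \<le> exp (- (k * (z * s t)))"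
      using sz k(2) by (rule eventually_compose_filterlim[rotated])
    moreover have "\<forall>\<^sub>F t in at_top. prob {\<omega> \<in> space M. q * (\<eta> * s t) \<le> Y (\<eta> * s t) \<omega>} \<le> exp (- (l * (\<eta> * s t)))"
      using s\<eta> l(2) by (rule eventually_compose_filterlim[rotated])
    moreover have "\<forall>\<^sub>F t in at_top. exp (- (k * (z * s t))) \<le> 1 / 4" by (rule quarter[OF k(1) sz])
    moreover have "\<forall>\<^sub>F t in at_top. exp (- (l * (\<eta> * s t))) \<le> 1 / 4" by (rule quarter[OF l(1) s\<eta>])
    moreover have "\<forall>\<^sub>F t in at_top. exp (- (stable_rate \<nu> \<eta> * (1 / a t))) \<le> 1 / 4" by (rule quarter[OF R\<eta> v])
    moreover have "\<forall>\<^sub>F t in at_top. exp (- (\<epsilon> / 4 * (1 / a t))) \<le> 1 / 4" by (rule quarter[OF \<epsilon>4 v])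
    ultimately show ?thesis using eventually_gt_at_top[of 0]
    proof eventually_elim
      case (elim t)
      define u where "u = z * s t"
      define w where "w = \<eta> * s t"
      have st: "0 < s t" using spos[OF elim(8)] .
      have u: "0 \<le> u" and w: "0 \<le> w" using z0 \<eta> st by (auto simp: u_def w_def)
      have t: "0 \<le> t" using elim(8) by simp
      note at = a(1)[OF elim(8)]
      note [measurable] = Xm[OF u] Ym[OF w] Lm[OF t] Km[OF t]
      let ?C = "{r * u<..} \<times> {..<q * w}"
      have C[measurable]: "?C \<in> sets (borel \<Otimes>\<^sub>M borel)" by (intro pair_measureI) auto
      have pL: "exp (- (1 / a t * (stable_rate \<nu> z + \<epsilon> / 4))) \<le> prob {\<omega> \<in> space M. L t \<omega> \<in> {u<..}}"
        using s0[OF elim(8) at elim(1)] by (simp add: u_def s_def)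
      have pK: "1 / 2 \<le> prob {\<omega> \<in> space M. K t \<omega> \<in> {..w}}"
      proof -
        have "prob {\<omega> \<in> space M. w < K t \<omega>} \<le> exp (- (1 / a t * stable_rate \<nu> \<eta>))"
          unfolding w_def s_def using inverse_stable_upper_tail_le[OF \<nu> K \<eta>(1) elim(8) at] .
        then have "prob {\<omega> \<in> space M. w < K t \<omega>} \<le> 1 / 4" using elim(6) by (simp add: mult.commute)
        moreover have "prob {\<omega> \<in> space M. \<not> w < K t \<omega>} = 1 - prob {\<omega> \<in> space M. w < K t \<omega>}"
          by (rule prob_neg) measurable
        ultimately show ?thesis by (simp add: not_less)
      qed
      have pC: "1 / 2 \<le> prob {\<omega> \<in> space M. (X u \<omega>, Y w \<omega>) \<in> ?C}"
      proof -
        have "prob {\<omega> \<in> space M. \<not> (X u \<omega>, Y w \<omega>) \<in> ?C}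
            \<le> prob ({\<omega> \<in> space M. X u \<omega> \<le> r * u} \<union> {\<omega> \<in> space M. q * w \<le> Y w \<omega>})"
          by (intro finite_measure_mono) auto
        also have "\<dots> \<le> prob {\<omega> \<in> space M. X u \<omega> \<le> r * u} + prob {\<omega> \<in> space M. q * w \<le> Y w \<omega>}"
          by (rule measure_Un_le) measurable
        also have "\<dots> \<le> 1 / 4 + 1 / 4"
          unfolding u_def w_def using elim(2-5) by linarith
        finally have "prob {\<omega> \<in> space M. \<not> (X u \<omega>, Y w \<omega>) \<in> ?C} \<le> 1 / 2" by simp
        moreover have "prob {\<omega> \<in> space M. \<not> (X u \<omega>, Y w \<omega>) \<in> ?C} = 1 - prob {\<omega> \<in> space M. (X u \<omega>, Y w \<omega>) \<in> ?C}"
          by (rule prob_neg) measurable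
        ultimately show ?thesis by linarith
      qed
      let ?E = "{\<omega> \<in> space M. (X u \<omega>, Y w \<omega>) \<in> ?C \<and> L t \<omega> \<in> {u<..} \<and> K t \<omega> \<in> {..w}}"
      have E[measurable]: "?E \<in> sets M" by measurable
      have "1 / 2 * (exp (- (1 / a t * (stable_rate \<nu> z + \<epsilon> / 4))) * (1 / 2)) \<le> prob ?E"
        unfolding indep_pairs_prob_factorizes[OF indep_XY_LK[OF t u w] indep_LK[OF t] C
            greaterThan_borel atMost_borel]
        by (intro mult_mono pC pL pK mult_nonneg_nonneg measure_nonneg) auto
      moreover have "exp (- (1 / a t * (stable_rate \<nu> (x / m) + \<epsilon>)))
          \<le> exp (- (\<epsilon> / 4 * (1 / a t))) * exp (- (1 / a t * (stable_rate \<nu> z + \<epsilon> / 4)))"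
      proof -
        have "1 / a t * (stable_rate \<nu> z + \<epsilon> / 2) \<le> 1 / a t * (stable_rate \<nu> (x / m) + \<epsilon>)"
          using at z by (intro mult_left_mono) auto
        then show ?thesis by (simp add: exp_add[symmetric] algebra_simps)
      qed
      moreover have "exp (- (\<epsilon> / 4 * (1 / a t))) * exp (- (1 / a t * (stable_rate \<nu> z + \<epsilon> / 4)))
          \<le> 1 / 4 * exp (- (1 / a t * (stable_rate \<nu> z + \<epsilon> / 4)))"
        using elim(7) by (rule mult_right_mono) simp
      ultimately have 1: "exp (- (1 / a t * (stable_rate \<nu> (x / m) + \<epsilon>))) \<le> prob ?E" by linarith
      have "AE \<omega> in M. \<omega> \<in> ?E \<longrightarrow> x < Z t \<omega>"
        using subordinatorD(4)[OF X(1)] subordinatorD(4)[OF Y(1)] L0[OF t] K0[OF t]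
      proof eventually_elim
        case (elim \<omega>)
        show ?case
        proof (intro impI)
          assume \<omega>: "\<omega> \<in> ?E"
          have "X u \<omega> \<le> X (L t \<omega>) \<omega>" using mono_onD[OF elim(1), of u "L t \<omega>"] u \<omega> by auto
          moreover have "Y (K t \<omega>) \<omega> \<le> Y w \<omega>" using mono_onD[OF elim(2), of "K t \<omega>" w] elim(4) \<omega> by auto
          ultimately have "r * u - q * w < X (L t \<omega>) \<omega> - Y (K t \<omega>) \<omega>" using \<omega> by auto
          moreover have "r * u - q * w = (r * z - q * \<eta>) * s t"
            by (simp add: u_def w_def algebra_simps)
          then have "r * u - q * w = x * s t" unfolding \<eta>(2) by simp
          ultimately show "x < Z t \<omega>" using st by (simp add: Z_def pos_less_divide_eq)
        qed
      qed
      then have "AE \<omega> in completion M. \<omega> \<in> ?E \<longrightarrow> x < Z t \<omega>" by (rule AE_completion)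
      then have "AE \<omega> in completion M. \<omega> \<in> ?E \<longrightarrow> \<omega> \<in> {\<omega> \<in> space (completion M). x < Z t \<omega>}"
        by eventually_elim simp
      moreover have "{\<omega> \<in> space (completion M). x < Z t \<omega>} \<in> sets (completion M)"
        using Zm[OF elim(8)] by measurable
      ultimately have "measure (completion M) ?E \<le> measure (completion M) {\<omega> \<in> space (completion M). x < Z t \<omega>}"
        by (rule compl.finite_measure_mono_AE)
      then show ?case using 1 unfolding measure_completion[OF E] by (rule order_trans[rotated])
    qed
  qed
  show ?thesis
    unfolding right_tail_decay_def m_def[symmetric]
    using upper lower by (auto simp: eventually_conj_iff)
qed

section \<open>Shape of the rate function\<close>

lemma J_MD_neg:
  assumes "0 \<le> x"
  shows "J_MD \<nu> m1 m2 (- x) = J_MD \<nu> m2 m1 x"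
  using assms by (cases "x = 0") (simp_all add: J_MD_def)

lemma J_MD_eq_stable_rate:
  assumes "0 \<le> x"
  shows "J_MD \<nu> m1 m2 x = stable_rate \<nu> (x / m1)"
  using assms by (simp add: J_MD_def stable_rate_def)

lemma J_MD_strict_mono:
  assumes \<nu>: "0 < \<nu>" "\<nu> < 1" and m: "0 < m1"
  shows "strict_mono_on {0..} (J_MD \<nu> m1 m2)"
proof (rule strict_mono_onI)
  fix x y :: real assume xy: "x \<in> {0..}" "y \<in> {0..}" "x < y"
  then have "(x / m1) powr (1 / (1 - \<nu>)) < (y / m1) powr (1 / (1 - \<nu>))"
    using \<nu> m by (intro powr_less_mono2) (auto simp: divide_strict_right_mono)
  then show "J_MD \<nu> m1 m2 x < J_MD \<nu> m1 m2 y"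
    using xy stable_rate_factor_pos[OF \<nu>] by (simp add: J_MD_def)
qed

lemma J_MD_unbounded:
  assumes \<nu>: "0 < \<nu>" "\<nu> < 1" and m: "0 < m1"
  shows "\<exists>x\<ge>0. b \<le> J_MD \<nu> m1 m2 x"
proof -
  define c where "c = \<nu> powr (\<nu> / (1 - \<nu>)) - \<nu> powr (1 / (1 - \<nu>))"
  have c: "0 < c" using stable_rate_factor_pos[OF \<nu>] by (simp add: c_def)
  define x where "x = m1 * (\<bar>b\<bar> / c) powr (1 - \<nu>)"
  have "0 \<le> x" using m by (simp add: x_def)
  moreover have "J_MD \<nu> m1 m2 x = \<bar>b\<bar>"
    using \<open>0 \<le> x\<close> m c \<nu> unfolding J_MD_def c_def[symmetric] by (simp add: x_def powr_powr)
  ultimately show ?thesis by (intro exI[of _ x]) auto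
qed

lemma J_MD_continuous:
  assumes \<nu>: "0 < \<nu>" "\<nu> < 1" and m: "0 < m1" "0 < m2"
  shows "continuous_on UNIV (J_MD \<nu> m1 m2)"
proof -
  have part: "continuous_on UNIV (\<lambda>x. (max 0 (g x) / m) powr (1 / (1 - \<nu>)))"
    if "continuous_on UNIV g" "0 < m" for g :: "real \<Rightarrow> real" and m
  proof (rule continuous_on_powr')
    show "continuous_on UNIV (\<lambda>x. max 0 (g x) / m)"
      using that by (intro continuous_on_divide continuous_on_max continuous_on_const) auto
  qed (use \<nu> that in auto)
  have "J_MD \<nu> m1 m2 = (\<lambda>x. (\<nu> powr (\<nu> / (1 - \<nu>)) - \<nu> powr (1 / (1 - \<nu>)))
      * ((max 0 x / m1) powr (1 / (1 - \<nu>)) + (max 0 (- x) / m2) powr (1 / (1 - \<nu>))))"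
    by (auto simp: fun_eq_iff J_MD_def max_def)
  then show ?thesis
    by (simp only:) (intro continuous_on_mult continuous_on_add continuous_on_const part m
        continuous_on_id continuous_on_minus)
qed

section \<open>Passing from trajectories to fixed times\<close>

lemma trajectory_component:
  "0 \<le> t \<Longrightarrow> trajectory X \<omega> t = X t \<omega>"
  by (simp add: trajectory_def)

lemma evaluation_measurable:
  assumes "0 \<le> t"
  shows "(\<lambda>f. f t) \<in> measurable trajectory_space borel"
  unfolding trajectory_space_def using assms by (intro measurable_component_singleton) auto

lemma (in prob_space) indep_at_fixed_time:
  assumes "indep_var trajectory_space (trajectory X) trajectory_space (trajectory Y)" "0 \<le> t"
  shows "indep_var borel (X t) borel (Y t)"
  using indep_var_compose[OF assms(1) evaluation_measurable[OF assms(2)] evaluation_measurable[OF assms(2)]]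
  by (simp add: comp_def trajectory_component assms(2))

lemma (in prob_space) indep_pairs_at_fixed_times:
  assumes indep: "indep_var
      (trajectory_space \<Otimes>\<^sub>M trajectory_space) (\<lambda>\<omega>. (trajectory X \<omega>, trajectory Y \<omega>))
      (trajectory_space \<Otimes>\<^sub>M trajectory_space) (\<lambda>\<omega>. (trajectory L \<omega>, trajectory K \<omega>))"
    and t: "0 \<le> t" "0 \<le> u" "0 \<le> w"
  shows "indep_var (borel \<Otimes>\<^sub>M borel) (\<lambda>\<omega>. (X u \<omega>, Y w \<omega>)) (borel \<Otimes>\<^sub>M borel) (\<lambda>\<omega>. (L t \<omega>, K t \<omega>))"
    and "indep_var (borel \<Otimes>\<^sub>M borel) (\<lambda>\<omega>. (Y w \<omega>, X u \<omega>)) (borel \<Otimes>\<^sub>M borel) (\<lambda>\<omega>. (K t \<omega>, L t \<omega>))"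
proof -
  have eval: "(\<lambda>p. (fst p r, snd p q)) \<in> measurable (trajectory_space \<Otimes>\<^sub>M trajectory_space) (borel \<Otimes>\<^sub>M borel)"
    "(\<lambda>p. (snd p q, fst p r)) \<in> measurable (trajectory_space \<Otimes>\<^sub>M trajectory_space) (borel \<Otimes>\<^sub>M borel)"
    if "0 \<le> r" "0 \<le> q" for r q
    using that
    by (auto intro!: measurable_Pair measurable_compose[OF _ evaluation_measurable])
  show "indep_var (borel \<Otimes>\<^sub>M borel) (\<lambda>\<omega>. (X u \<omega>, Y w \<omega>)) (borel \<Otimes>\<^sub>M borel) (\<lambda>\<omega>. (L t \<omega>, K t \<omega>))"
    using indep_var_compose[OF indep eval(1)[OF t(2,3)] eval(1)[OF t(1,1)]]
    by (simp add: comp_def trajectory_component t)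
  show "indep_var (borel \<Otimes>\<^sub>M borel) (\<lambda>\<omega>. (Y w \<omega>, X u \<omega>)) (borel \<Otimes>\<^sub>M borel) (\<lambda>\<omega>. (K t \<omega>, L t \<omega>))"
    using indep_var_compose[OF indep eval(2)[OF t(2,3)] eval(2)[OF t(1,1)]]
    by (simp add: comp_def trajectory_component t)
qed

text \<open>
  The difference \<open>S1 1 - S2 1\<close> has the law of \<open>S 1\<close>, and independence passes its exponential
  moments on to each summand.
\<close>

lemma kappa_finite_near_0_of_difference:
  assumes S: "levy_process N S" and fin: "kappa_finite_near_0 N S"
    and S12: "subordinator M S1" "subordinator M S2"
    and indep: "prob_space.indep_var M borel (S1 1) borel (S2 1)"
    and dist: "distr N trajectory_space (trajectory S) =
         distr M trajectory_space (trajectory (\<lambda>t \<omega>. S1 t \<omega> - S2 t \<omega>))"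
  shows "kappa_finite_near_0 M S1" "kappa_finite_near_0 M S2"
proof -
  interpret prob_space M by (rule subordinatorD(1)[OF S12(1)])
  obtain \<delta> where \<delta>: "0 < \<delta>" "\<And>\<theta>. \<bar>\<theta>\<bar> < \<delta> \<Longrightarrow> integrable N (\<lambda>\<omega>. exp (\<theta> * S 1 \<omega>))"
    using fin unfolding kappa_finite_near_0_def by blast
  have trajm: "trajectory Z \<in> measurable Q trajectory_space"
    if "\<And>t. 0 \<le> t \<Longrightarrow> Z t \<in> borel_measurable Q" for Z :: "real \<Rightarrow> 'c \<Rightarrow> real" and Q :: "'c measure"
    unfolding trajectory_space_def trajectory_def[abs_def] using that
    by (intro measurable_restrict) auto
  have tS: "trajectory S \<in> measurable N trajectory_space"
    using S by (intro trajm) (simp add: levy_process_def)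
  have tD: "trajectory (\<lambda>t \<omega>. S1 t \<omega> - S2 t \<omega>) \<in> measurable M trajectory_space"
    using subordinatorD(2) S12 by (intro trajm borel_measurable_diff) blast+
  have [measurable]: "(\<lambda>f. exp (\<theta> * f 1)) \<in> borel_measurable trajectory_space" for \<theta> :: real
    using evaluation_measurable[of 1] by measurable
  have "integrable M (\<lambda>\<omega>. exp (\<theta> * (S1 1 \<omega> - S2 1 \<omega>)))" if "\<bar>\<theta>\<bar> < \<delta>" for \<theta>
  proof -
    have "integrable (distr N trajectory_space (trajectory S)) (\<lambda>f. exp (\<theta> * f 1))"
      using \<delta>(2)[OF that] tS by (subst integrable_distr_eq) (simp_all add: trajectory_component)
    then show ?thesis
      unfolding dist using tD by (subst (asm) integrable_distr_eq) (simp_all add: trajectory_component)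
  qed
  note factor = mgf_factor_integrable[OF indep this]
  show "kappa_finite_near_0 M S1"
    unfolding kappa_finite_near_0_def using \<delta>(1) factor(1) by blast
  have "integrable M (\<lambda>\<omega>. exp (\<theta> * S2 1 \<omega>))" if "\<bar>\<theta>\<bar> < \<delta>" for \<theta>
    using factor(2)[of "- \<theta>"] that by simp
  then show "kappa_finite_near_0 M S2"
    unfolding kappa_finite_near_0_def using \<delta>(1) by blast
qed

section \<open>The moderate deviation principle\<close>

theorem proposition4p3:
  fixes \<nu> m1 m2 :: real
    and N :: "'b measure" and S :: "real \<Rightarrow> 'b \<Rightarrow> real"
    and M :: "'a measure" and S1 S2 L1 L2 :: "real \<Rightarrow> 'a \<Rightarrow> real"
    and a :: "real \<Rightarrow> real"
  assumes "0 < \<nu>" and "\<nu> < 1"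
    and "levy_process N S"
    and "kappa_finite_near_0 N S"
    and "bounded_variation_process N S"
    and "\<not> subordinator N S"
    and "subordinator M S1" and "non_null M S1"
    and "subordinator M S2" and "non_null M S2"
    and "prob_space.indep_var M
           trajectory_space (trajectory S1) trajectory_space (trajectory S2)"
    and "distr N trajectory_space (trajectory S) =
         distr M trajectory_space (trajectory (\<lambda>t \<omega>. S1 t \<omega> - S2 t \<omega>))"
    and "m1 = deriv (kappa M S1) 0" and "m2 = deriv (kappa M S2) 0"
    and "inverse_stable_subordinator \<nu> M L1"
    and "inverse_stable_subordinator \<nu> M L2"
    and "prob_space.indep_var M
           trajectory_space (trajectory L1) trajectory_space (trajectory L2)"
    and "prob_space.indep_var M
           (trajectory_space \<Otimes>\<^sub>M trajectory_space) (\<lambda>\<omega>. (trajectory S1 \<omega>, trajectory S2 \<omega>))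
           (trajectory_space \<Otimes>\<^sub>M trajectory_space) (\<lambda>\<omega>. (trajectory L1 \<omega>, trajectory L2 \<omega>))"
    and "\<And>t. 0 < t \<Longrightarrow> 0 < a t"
    and "(a \<longlongrightarrow> 0) at_top"
    and "filterlim (\<lambda>t. a t * t) at_top at_top"
  shows "satisfies_LDP (completion M)
           (\<lambda>t \<omega>. (a t * t) powr alpha1 \<nu> * (S1 (L1 t \<omega>) \<omega> - S2 (L2 t \<omega>) \<omega>) / t)
           (\<lambda>t. 1 / a t)
           (\<lambda>x. ereal (J_MD \<nu> m1 m2 x))
       \<and> good_rate_function (\<lambda>x. ereal (J_MD \<nu> m1 m2 x))"
proof -
  interpret prob_space M by (rule subordinatorD(1)[OF assms(7)])
  note a = assms(19-21)
  have ind: "indep_var borel (S1 1) borel (S2 1)"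
    by (rule indep_at_fixed_time[OF assms(11)]) simp
  note fin = kappa_finite_near_0_of_difference[OF assms(3,4,7,9) ind assms(12)]
  have m: "0 < m1" "0 < m2"
    using subordinator_kappa_derivative(2)[OF assms(7,8) fin(1)]
      subordinator_kappa_derivative(2)[OF assms(9,10) fin(2)] assms(13,14) by simp_all
  define s where "s t = (a t * t) powr \<nu> / a t" for t
  define Z where "Z = (\<lambda>t \<omega>. (a t * t) powr alpha1 \<nu> * (S1 (L1 t \<omega>) \<omega> - S2 (L2 t \<omega>) \<omega>) / t)"
  have Z_eq: "Z t \<omega> = (S1 (L1 t \<omega>) \<omega> - S2 (L2 t \<omega>) \<omega>) / s t" if t: "0 < t" for t \<omega>
  proof -
    have at: "0 < a t" using a(1) t .
    have "(a t * t) powr (1 - \<nu>) = a t * t / (a t * t) powr \<nu>"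
      using at t by (simp add: powr_diff)
    then show ?thesis using at t by (simp add: Z_def s_def alpha1_def)
  qed
  have "right_tail_decay (completion M) (\<lambda>t \<omega>. (S1 (L1 t \<omega>) \<omega> - S2 (L2 t \<omega>) \<omega>) / s t)
      (\<lambda>t. 1 / a t) (\<lambda>x. stable_rate \<nu> (x / deriv (kappa M S1) 0))"
    unfolding s_def
    by (rule time_changed_difference_right_tail[OF assms(1,2,7,8) fin(1) assms(9,10) fin(2) assms(15,16)
        indep_at_fixed_time[OF assms(17)] indep_pairs_at_fixed_times(1)[OF assms(18)] a])
  then have right: "right_tail_decay (completion M) Z (\<lambda>t. 1 / a t) (J_MD \<nu> m1 m2)"
    by (rule right_tail_decay_cong) (simp_all add: Z_eq J_MD_eq_stable_rate assms(13))
  have "right_tail_decay (completion M) (\<lambda>t \<omega>. (S2 (L2 t \<omega>) \<omega> - S1 (L1 t \<omega>) \<omega>) / s t)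
      (\<lambda>t. 1 / a t) (\<lambda>x. stable_rate \<nu> (x / deriv (kappa M S2) 0))"
    unfolding s_def
    by (rule time_changed_difference_right_tail[OF assms(1,2,9,10) fin(2) assms(7,8) fin(1) assms(16,15)
        indep_var_sym[OF indep_at_fixed_time[OF assms(17)]] indep_pairs_at_fixed_times(2)[OF assms(18)] a])
  then have left: "right_tail_decay (completion M) (\<lambda>t \<omega>. - Z t \<omega>) (\<lambda>t. 1 / a t) (\<lambda>x. J_MD \<nu> m1 m2 (- x))"
    by (rule right_tail_decay_cong)
      (simp_all add: Z_eq J_MD_neg J_MD_eq_stable_rate assms(14) minus_divide_left)
  have meas: "Z t \<in> borel_measurable (completion M)" if "0 < t" for t
    unfolding Z_def
    by (intro borel_measurable_divide borel_measurable_diff borel_measurable_times borel_measurable_const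
        time_changed_subordinator_measurable[OF assms(7,15)] time_changed_subordinator_measurable[OF assms(9,16)]) (use that in auto)
  have "\<forall>\<^sub>F t in at_top. 0 < a t"
    using eventually_gt_at_top[of 0] by eventually_elim (rule a)
  with a(2) have "filterlim a (at_right 0) at_top" by (rule tendsto_imp_filterlim_at_right)
  then have speed: "filterlim (\<lambda>t. 1 / a t) at_top at_top"
    by (simp add: divide_inverse filterlim_compose[OF filterlim_inverse_at_top_right])
  have neg: "strict_mono_on {0..} (\<lambda>x. J_MD \<nu> m1 m2 (- x))"
    using strict_mono_onD[OF J_MD_strict_mono[OF assms(1,2) m(2)]]
    by (intro strict_mono_onI) (simp add: J_MD_neg)
  have negunb: "\<exists>x\<ge>0. b \<le> J_MD \<nu> m1 m2 (- x)" for b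
  proof -
    obtain x where "0 \<le> x" "b \<le> J_MD \<nu> m2 m1 x" using J_MD_unbounded[OF assms(1,2) m(2)] by blast
    then show ?thesis by (intro exI[of _ x]) (simp add: J_MD_neg)
  qed
  show ?thesis
    unfolding Z_def[symmetric]
    by (rule satisfies_LDP_of_tail_decay[OF prob_space_completion meas speed J_MD_continuous[OF assms(1,2) m]
        _ J_MD_strict_mono[OF assms(1,2) m(1)] neg J_MD_unbounded[OF assms(1,2) m(1)] negunb right left])
      (simp_all add: J_MD_def)
qed

end
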